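(* Let $R$ be a ring, and let $G$ be a non-trivial group. (1) If $R$ is a generalized quasi $t$-fine ring and $G$ is a locally finite $p$-group for some prime $p$ with $p\in \mathrm{Nil}(R)$, then the group ring $RG$ is generalized quasi $t$-fine. (2) If $R$ is commutative and $RG$ is a generalized quasi $t$-fine ring, then $R$ is a generalized quasi $t$-fine ring and $G$ is a $p$-group for some prime $p$ with $p\in \mathrm{J}(R)$.
   Context: Rings are associative with identity $1$ (not necessarily commutative unless stated). For a ring $S$: $\mathrm{J}(S)$ is the Jacobson radical, $\mathrm{Nil}(S)$ the set of nilpotent elements, $\mathcal{U}(S)$ the group of units, $\mathcal{T}(S)$ the set of torsion units, i.e. units $u$ with $u^m=1$ for some $m\ge 1$, and $\mathcal{Q}(S)=\{q\in S : 1-xq\in \mathcal{U}(S)\text{ for every } x\in S \text{ with } xq=qx\}$ the set of quasinilpotent elements. $S$ is generalized quasi $t$-fine if $S\setminus \mathrm{J}(S)=\mathcal{T}(S)+\mathcal{Q}(S)$. For a prime $p$, "$p\in \mathrm{J}(R)$" and "$p\in \mathrm{Nil}(R)$" refer to the element $p\cdot 1_R$. A $p$-group is a (possibly infinite) group in which every element has order a power of $p$. A group is locally finite if each of its finitely generated subgroups is finite. *)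

theory Defs
  imports "HOL-Algebra.Algebra"
begin

text \<open>The Jacobson radical is the intersection of all maximal left ideals. The
  library's ideals are two-sided, so one-sided ideals are introduced here. For the
  zero ring the intersection is over the empty family and yields the carrier.\<close>

definition left_ideal :: "'r set \<Rightarrow> ('r, 'm) ring_scheme \<Rightarrow> bool"
  where "left_ideal I R \<longleftrightarrow>
    additive_subgroup I R \<and> (\<forall>x\<in>carrier R. \<forall>a\<in>I. x \<otimes>\<^bsub>R\<^esub> a \<in> I)"

definition maximal_left_ideal :: "'r set \<Rightarrow> ('r, 'm) ring_scheme \<Rightarrow> bool"
  where "maximal_left_ideal M R \<longleftrightarrow>
    left_ideal M R \<and> M \<noteq> carrier R \<and>
    (\<forall>I. left_ideal I R \<and> M \<subseteq> I \<longrightarrow> I = M \<or> I = carrier R)"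

definition jacobson_radical :: "('r, 'm) ring_scheme \<Rightarrow> 'r set"
  where "jacobson_radical R =
    {x \<in> carrier R. \<forall>M. maximal_left_ideal M R \<longrightarrow> x \<in> M}"

definition nilpotents :: "('r, 'm) ring_scheme \<Rightarrow> 'r set"
  where "nilpotents R = {x \<in> carrier R. \<exists>n::nat. n \<ge> 1 \<and> x [^]\<^bsub>R\<^esub> n = \<zero>\<^bsub>R\<^esub>}"

definition torsion_units :: "('r, 'm) ring_scheme \<Rightarrow> 'r set"
  where "torsion_units R = {u \<in> Units R. \<exists>m::nat. m \<ge> 1 \<and> u [^]\<^bsub>R\<^esub> m = \<one>\<^bsub>R\<^esub>}"

definition quasinilpotents :: "('r, 'm) ring_scheme \<Rightarrow> 'r set"
  where "quasinilpotents R =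
    {q \<in> carrier R. \<forall>x\<in>carrier R. x \<otimes>\<^bsub>R\<^esub> q = q \<otimes>\<^bsub>R\<^esub> x \<longrightarrow>
       \<one>\<^bsub>R\<^esub> \<ominus>\<^bsub>R\<^esub> (x \<otimes>\<^bsub>R\<^esub> q) \<in> Units R}"

definition generalized_quasi_t_fine :: "('r, 'm) ring_scheme \<Rightarrow> bool"
  where "generalized_quasi_t_fine R \<longleftrightarrow>
    carrier R - jacobson_radical R = torsion_units R <+>\<^bsub>R\<^esub> quasinilpotents R"

text \<open>The order of an element is \<open>0\<close> when it generates an infinite cyclic group, so
  every element of a \<open>p\<close>-group has finite order.\<close>

definition p_group :: "nat \<Rightarrow> ('g, 'n) monoid_scheme \<Rightarrow> bool"
  where "p_group p G \<longleftrightarrow> (\<forall>g\<in>carrier G. \<exists>k::nat. group.ord G g = p ^ k)"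

definition locally_finite_group :: "('g, 'n) monoid_scheme \<Rightarrow> bool"
  where "locally_finite_group G \<longleftrightarrow>
    (\<forall>A. finite A \<and> A \<subseteq> carrier G \<longrightarrow> finite (generate G A))"

text \<open>Elements of the group ring are the finitely supported functions from \<open>G\<close> to
  \<open>R\<close> (extensional, so that equality of elements is equality of functions), with
  convolution \<open>(a b)(g) = \<Sum>h. a(h) b(h\<inverse> g)\<close>. Infinite sums have a default value in the
  library, so the sum runs over the support of \<open>a\<close>.\<close>

definition group_ring ::
    "('r, 'm) ring_scheme \<Rightarrow> ('g, 'n) monoid_scheme \<Rightarrow> ('g \<Rightarrow> 'r) ring"
  where "group_ring R G =
    \<lparr>carrier = {a \<in> carrier G \<rightarrow>\<^sub>E carrier R. finite {g \<in> carrier G. a g \<noteq> \<zero>\<^bsub>R\<^esub>}},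
     monoid.mult = (\<lambda>a b. \<lambda>g\<in>carrier G.
       \<Oplus>\<^bsub>R\<^esub>h\<in>{h \<in> carrier G. a h \<noteq> \<zero>\<^bsub>R\<^esub>}. a h \<otimes>\<^bsub>R\<^esub> b (inv\<^bsub>G\<^esub> h \<otimes>\<^bsub>G\<^esub> g)),
     one = (\<lambda>g\<in>carrier G. if g = \<one>\<^bsub>G\<^esub> then \<one>\<^bsub>R\<^esub> else \<zero>\<^bsub>R\<^esub>),
     ring.zero = (\<lambda>g\<in>carrier G. \<zero>\<^bsub>R\<^esub>),
     add = (\<lambda>a b. \<lambda>g\<in>carrier G. a g \<oplus>\<^bsub>R\<^esub> b g)\<rparr>"

lemma (in abelian_monoid) finsum_swap_finite:
  assumes "finite A" "finite B" "\<And>x y. x \<in> A \<Longrightarrow> y \<in> B \<Longrightarrow> f x y \<in> carrier G"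
  shows "(\<Oplus>x\<in>A. \<Oplus>y\<in>B. f x y) = (\<Oplus>y\<in>B. \<Oplus>x\<in>A. f x y)"
  using assms
proof (induction A rule: finite_induct)
  case empty
  then show ?case by (simp add: finsum_zero)
next
  case (insert a A)
  have 1: "(\<lambda>x. \<Oplus>y\<in>B. f x y) \<in> A \<rightarrow> carrier G" "(\<Oplus>y\<in>B. f a y) \<in> carrier G"
    using insert.prems by (auto intro!: finsum_closed)
  have "(\<Oplus>x\<in>insert a A. \<Oplus>y\<in>B. f x y) = (\<Oplus>y\<in>B. f a y) \<oplus> (\<Oplus>y\<in>B. \<Oplus>x\<in>A. f x y)"
    using insert 1 by (subst finsum_insert) auto
  also have "\<dots> = (\<Oplus>y\<in>B. f a y \<oplus> (\<Oplus>x\<in>A. f x y))"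
    using insert.prems by (subst finsum_addf) (auto intro!: finsum_closed)
  also have "\<dots> = (\<Oplus>y\<in>B. \<Oplus>x\<in>insert a A. f x y)"
    using insert by (intro finsum_cong') (auto intro!: finsum_closed)
  finally show ?case .
qed

lemma group_ring_ring:
  assumes "ring R" "group G"
  shows "ring (group_ring R G)"
proof -
  interpret R: ring R by fact
  interpret G: group G by fact
  let ?S = "\<lambda>a. {h \<in> carrier G. a h \<noteq> \<zero>\<^bsub>R\<^esub>}"
  let ?C = "carrier (group_ring R G)"
  have C: "a \<in> ?C \<longleftrightarrow> a \<in> carrier G \<rightarrow>\<^sub>E carrier R \<and> finite (?S a)" for a
    by (simp add: group_ring_def)
  have cl: "a g \<in> carrier R" if "a \<in> ?C" "g \<in> carrier G" for a g
    using that by (auto simp: C)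
  have ext: "a = b" if "a \<in> ?C" "b \<in> ?C" "\<And>g. g \<in> carrier G \<Longrightarrow> a g = b g" for a b
    using that PiE_ext[of a "carrier G" "\<lambda>_. carrier R" b] unfolding C by blast
  have conv: "(a \<otimes>\<^bsub>group_ring R G\<^esub> b) g = (\<Oplus>\<^bsub>R\<^esub>h\<in>F. a h \<otimes>\<^bsub>R\<^esub> b (inv\<^bsub>G\<^esub> h \<otimes>\<^bsub>G\<^esub> g))"
    if "a \<in> ?C" "b \<in> ?C" "g \<in> carrier G" "finite F" "?S a \<subseteq> F" "F \<subseteq> carrier G" for a b g F
  proof -
    have "(a \<otimes>\<^bsub>group_ring R G\<^esub> b) g = (\<Oplus>\<^bsub>R\<^esub>h\<in>?S a. a h \<otimes>\<^bsub>R\<^esub> b (inv\<^bsub>G\<^esub> h \<otimes>\<^bsub>G\<^esub> g))"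
      using that by (simp add: group_ring_def)
    also have "\<dots> = (\<Oplus>\<^bsub>R\<^esub>h\<in>F. a h \<otimes>\<^bsub>R\<^esub> b (inv\<^bsub>G\<^esub> h \<otimes>\<^bsub>G\<^esub> g))"
    proof -
      have Fc: "h \<in> carrier G" if "h \<in> F" for h using that \<open>F \<subseteq> carrier G\<close> by blast
      show ?thesis
        by (intro R.add.finprod_mono_neutral_cong_left) (use that Fc in \<open>auto simp: cl\<close>)
    qed
    finally show ?thesis .
  qed
  let ?K = "\<lambda>a b. (\<lambda>(h,k). h \<otimes>\<^bsub>G\<^esub> k) ` (?S a \<times> ?S b)"
  have Kfin: "finite (?K a b)" "?K a b \<subseteq> carrier G" if "a \<in> ?C" "b \<in> ?C" for a b
    using that by (auto simp: C)
  have supp: "?S (a \<otimes>\<^bsub>group_ring R G\<^esub> b) \<subseteq> ?K a b" if ab: "a \<in> ?C" "b \<in> ?C" for a b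
  proof
    fix g assume g: "g \<in> ?S (a \<otimes>\<^bsub>group_ring R G\<^esub> b)"
    show "g \<in> ?K a b"
    proof (rule ccontr)
      assume n: "g \<notin> ?K a b"
      have "b (inv\<^bsub>G\<^esub> h \<otimes>\<^bsub>G\<^esub> g) = \<zero>\<^bsub>R\<^esub>" if "h \<in> ?S a" for h
      proof (rule ccontr)
        assume "b (inv\<^bsub>G\<^esub> h \<otimes>\<^bsub>G\<^esub> g) \<noteq> \<zero>\<^bsub>R\<^esub>"
        then have "(h, inv\<^bsub>G\<^esub> h \<otimes>\<^bsub>G\<^esub> g) \<in> ?S a \<times> ?S b" using that g by auto
        moreover have "g = h \<otimes>\<^bsub>G\<^esub> (inv\<^bsub>G\<^esub> h \<otimes>\<^bsub>G\<^esub> g)"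
          using that g by (simp add: G.m_assoc[symmetric])
        ultimately show False using n by (metis (mono_tags, lifting) case_prod_conv image_eqI)
      qed
      then have "(\<Oplus>\<^bsub>R\<^esub>h\<in>?S a. a h \<otimes>\<^bsub>R\<^esub> b (inv\<^bsub>G\<^esub> h \<otimes>\<^bsub>G\<^esub> g)) = \<zero>\<^bsub>R\<^esub>"
        using ab by (intro R.add.finprod_one_eqI) (auto simp: cl)
      then have "(a \<otimes>\<^bsub>group_ring R G\<^esub> b) g = \<zero>\<^bsub>R\<^esub>"
        using g by (simp add: group_ring_def)
      with g show False by simp
    qed
  qed
  have mcl: "a \<otimes>\<^bsub>group_ring R G\<^esub> b \<in> ?C" if ab: "a \<in> ?C" "b \<in> ?C" for a b
  proof -
    have "finite (?S (a \<otimes>\<^bsub>group_ring R G\<^esub> b))"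
      by (rule finite_subset[OF supp[OF ab] Kfin(1)[OF ab]])
    moreover have "a \<otimes>\<^bsub>group_ring R G\<^esub> b \<in> carrier G \<rightarrow>\<^sub>E carrier R"
      using ab cl by (auto simp: group_ring_def intro!: R.finsum_closed R.m_closed)
    ultimately show ?thesis by (simp add: C)
  qed
  have acl: "a \<oplus>\<^bsub>group_ring R G\<^esub> b \<in> ?C" if ab: "a \<in> ?C" "b \<in> ?C" for a b
  proof -
    have "finite (?S a \<union> ?S b)" using ab by (simp add: C)
    moreover have "?S (a \<oplus>\<^bsub>group_ring R G\<^esub> b) \<subseteq> ?S a \<union> ?S b"
      using ab by (auto simp: group_ring_def)
    ultimately have "finite (?S (a \<oplus>\<^bsub>group_ring R G\<^esub> b))" by (rule finite_subset[rotated])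
    moreover have "a \<oplus>\<^bsub>group_ring R G\<^esub> b \<in> carrier G \<rightarrow>\<^sub>E carrier R"
      using ab by (auto simp: group_ring_def)
    ultimately show ?thesis by (simp add: C)
  qed
  have add: "(a \<oplus>\<^bsub>group_ring R G\<^esub> b) g = a g \<oplus>\<^bsub>R\<^esub> b g" if "g \<in> carrier G" for a b g
    using that by (simp add: group_ring_def)
  have zcl: "\<zero>\<^bsub>group_ring R G\<^esub> \<in> ?C" by (auto simp: group_ring_def)
  have ocl: "\<one>\<^bsub>group_ring R G\<^esub> \<in> ?C"
  proof -
    have "?S \<one>\<^bsub>group_ring R G\<^esub> \<subseteq> {\<one>\<^bsub>G\<^esub>}" by (auto simp: group_ring_def split: if_splits)
    then have "finite (?S \<one>\<^bsub>group_ring R G\<^esub>)" by (rule finite_subset) simp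
    then show ?thesis unfolding C by (auto simp: group_ring_def)
  qed
  have zero: "\<zero>\<^bsub>group_ring R G\<^esub> g = \<zero>\<^bsub>R\<^esub>" if "g \<in> carrier G" for g
    using that by (simp add: group_ring_def)
  have one: "\<one>\<^bsub>group_ring R G\<^esub> g = (if g = \<one>\<^bsub>G\<^esub> then \<one>\<^bsub>R\<^esub> else \<zero>\<^bsub>R\<^esub>)" if "g \<in> carrier G" for g
    using that by (simp add: group_ring_def)
  have inv: "inv\<^bsub>G\<^esub> h \<otimes>\<^bsub>G\<^esub> g \<in> carrier G" if "h \<in> carrier G" "g \<in> carrier G" for g h
    using that by simp
  have assoc: "a \<otimes>\<^bsub>group_ring R G\<^esub> b \<otimes>\<^bsub>group_ring R G\<^esub> c = a \<otimes>\<^bsub>group_ring R G\<^esub> (b \<otimes>\<^bsub>group_ring R G\<^esub> c)"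
    if abc: "a \<in> ?C" "b \<in> ?C" "c \<in> ?C" for a b c
  proof (rule ext)
    fix g assume g: "g \<in> carrier G"
    have fa: "finite (?S a)" using abc by (simp add: C)
    obtain K where K: "finite K" "K \<subseteq> carrier G" "?S (a \<otimes>\<^bsub>group_ring R G\<^esub> b) \<subseteq> K"
      and Kab: "\<And>h l. h \<in> ?S a \<Longrightarrow> l \<in> ?S b \<Longrightarrow> h \<otimes>\<^bsub>G\<^esub> l \<in> K"
      using that[OF Kfin[OF abc(1,2)] supp[OF abc(1,2)]] by blast
    have Kc: "k \<in> carrier G" if "k \<in> K" for k using that K(2) by blast
    have "(a \<otimes>\<^bsub>group_ring R G\<^esub> b \<otimes>\<^bsub>group_ring R G\<^esub> c) g
        = (\<Oplus>\<^bsub>R\<^esub>k\<in>K. (a \<otimes>\<^bsub>group_ring R G\<^esub> b) k \<otimes>\<^bsub>R\<^esub> c (inv\<^bsub>G\<^esub> k \<otimes>\<^bsub>G\<^esub> g))"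
      by (rule conv[OF mcl[OF abc(1,2)] abc(3) g K(1,3,2)])
    also have "\<dots> = (\<Oplus>\<^bsub>R\<^esub>k\<in>K. \<Oplus>\<^bsub>R\<^esub>h\<in>?S a. a h \<otimes>\<^bsub>R\<^esub> (b (inv\<^bsub>G\<^esub> h \<otimes>\<^bsub>G\<^esub> k) \<otimes>\<^bsub>R\<^esub> c (inv\<^bsub>G\<^esub> k \<otimes>\<^bsub>G\<^esub> g)))"
    proof (rule R.finsum_cong')
      fix k assume "k \<in> K"
      then have k: "k \<in> carrier G" using Kc by blast
      have "(a \<otimes>\<^bsub>group_ring R G\<^esub> b) k \<otimes>\<^bsub>R\<^esub> c (inv\<^bsub>G\<^esub> k \<otimes>\<^bsub>G\<^esub> g)
        = (\<Oplus>\<^bsub>R\<^esub>h\<in>?S a. a h \<otimes>\<^bsub>R\<^esub> b (inv\<^bsub>G\<^esub> h \<otimes>\<^bsub>G\<^esub> k)) \<otimes>\<^bsub>R\<^esub> c (inv\<^bsub>G\<^esub> k \<otimes>\<^bsub>G\<^esub> g)"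
        using k by (simp add: group_ring_def)
      also have "\<dots> = (\<Oplus>\<^bsub>R\<^esub>h\<in>?S a. a h \<otimes>\<^bsub>R\<^esub> b (inv\<^bsub>G\<^esub> h \<otimes>\<^bsub>G\<^esub> k) \<otimes>\<^bsub>R\<^esub> c (inv\<^bsub>G\<^esub> k \<otimes>\<^bsub>G\<^esub> g))"
        using abc k g fa by (intro R.finsum_ldistr) (auto simp: cl)
      also have "\<dots> = (\<Oplus>\<^bsub>R\<^esub>h\<in>?S a. a h \<otimes>\<^bsub>R\<^esub> (b (inv\<^bsub>G\<^esub> h \<otimes>\<^bsub>G\<^esub> k) \<otimes>\<^bsub>R\<^esub> c (inv\<^bsub>G\<^esub> k \<otimes>\<^bsub>G\<^esub> g)))"
        using abc k g by (intro R.finsum_cong') (auto simp: cl R.m_assoc)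
      finally show "(a \<otimes>\<^bsub>group_ring R G\<^esub> b) k \<otimes>\<^bsub>R\<^esub> c (inv\<^bsub>G\<^esub> k \<otimes>\<^bsub>G\<^esub> g) = \<dots>" .
    qed (use abc g Kc in \<open>auto simp: cl intro!: R.finsum_closed\<close>)
    also have "\<dots> = (\<Oplus>\<^bsub>R\<^esub>h\<in>?S a. \<Oplus>\<^bsub>R\<^esub>k\<in>K. a h \<otimes>\<^bsub>R\<^esub> (b (inv\<^bsub>G\<^esub> h \<otimes>\<^bsub>G\<^esub> k) \<otimes>\<^bsub>R\<^esub> c (inv\<^bsub>G\<^esub> k \<otimes>\<^bsub>G\<^esub> g)))"
      by (rule R.finsum_swap_finite) (use abc g Kc fa K in \<open>auto simp: cl\<close>)
    also have "\<dots> = (\<Oplus>\<^bsub>R\<^esub>h\<in>?S a. a h \<otimes>\<^bsub>R\<^esub> (b \<otimes>\<^bsub>group_ring R G\<^esub> c) (inv\<^bsub>G\<^esub> h \<otimes>\<^bsub>G\<^esub> g))"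
    proof (rule R.finsum_cong')
      fix h assume h: "h \<in> ?S a"
      then have hG: "h \<in> carrier G" by simp
      let ?L = "(\<lambda>k. inv\<^bsub>G\<^esub> h \<otimes>\<^bsub>G\<^esub> k) ` K"
      have sub: "?S b \<subseteq> ?L"
      proof
        fix l assume l: "l \<in> ?S b"
        then have "h \<otimes>\<^bsub>G\<^esub> l \<in> K" using h Kab by blast
        moreover have "l = inv\<^bsub>G\<^esub> h \<otimes>\<^bsub>G\<^esub> (h \<otimes>\<^bsub>G\<^esub> l)" using l hG by (simp add: G.m_assoc[symmetric])
        ultimately show "l \<in> ?L" by blast
      qed
      have L: "finite ?L" "?L \<subseteq> carrier G" using K hG Kc by auto
      have "(b \<otimes>\<^bsub>group_ring R G\<^esub> c) (inv\<^bsub>G\<^esub> h \<otimes>\<^bsub>G\<^esub> g)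
        = (\<Oplus>\<^bsub>R\<^esub>l\<in>?L. b l \<otimes>\<^bsub>R\<^esub> c (inv\<^bsub>G\<^esub> l \<otimes>\<^bsub>G\<^esub> (inv\<^bsub>G\<^esub> h \<otimes>\<^bsub>G\<^esub> g)))"
        by (rule conv[OF abc(2,3) inv[OF hG g] L(1) sub L(2)])
      also have "\<dots> = (\<Oplus>\<^bsub>R\<^esub>k\<in>K. b (inv\<^bsub>G\<^esub> h \<otimes>\<^bsub>G\<^esub> k) \<otimes>\<^bsub>R\<^esub> c (inv\<^bsub>G\<^esub> (inv\<^bsub>G\<^esub> h \<otimes>\<^bsub>G\<^esub> k) \<otimes>\<^bsub>G\<^esub> (inv\<^bsub>G\<^esub> h \<otimes>\<^bsub>G\<^esub> g)))"
      proof (rule R.finsum_reindex)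
        show "inj_on (\<lambda>k. inv\<^bsub>G\<^esub> h \<otimes>\<^bsub>G\<^esub> k) (K)"
          using hG Kc by (intro inj_onI) (metis G.inv_closed G.l_cancel)
      qed (use abc g Kc L hG in \<open>auto simp: cl\<close>)
      also have "\<dots> = (\<Oplus>\<^bsub>R\<^esub>k\<in>K. b (inv\<^bsub>G\<^esub> h \<otimes>\<^bsub>G\<^esub> k) \<otimes>\<^bsub>R\<^esub> c (inv\<^bsub>G\<^esub> k \<otimes>\<^bsub>G\<^esub> g))"
      proof (rule R.finsum_cong')
        fix k assume "k \<in> K"
        then have k: "k \<in> carrier G" using Kc by blast
        have "inv\<^bsub>G\<^esub> (inv\<^bsub>G\<^esub> h \<otimes>\<^bsub>G\<^esub> k) \<otimes>\<^bsub>G\<^esub> (inv\<^bsub>G\<^esub> h \<otimes>\<^bsub>G\<^esub> g) = inv\<^bsub>G\<^esub> k \<otimes>\<^bsub>G\<^esub> g"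
        proof -
          have "h \<otimes>\<^bsub>G\<^esub> (inv\<^bsub>G\<^esub> h \<otimes>\<^bsub>G\<^esub> g) = g"
            using hG g by (simp add: G.m_assoc[symmetric])
          then show ?thesis using k hG g by (simp add: G.inv_mult_group G.m_assoc)
        qed
        then show "b (inv\<^bsub>G\<^esub> h \<otimes>\<^bsub>G\<^esub> k) \<otimes>\<^bsub>R\<^esub> c (inv\<^bsub>G\<^esub> (inv\<^bsub>G\<^esub> h \<otimes>\<^bsub>G\<^esub> k) \<otimes>\<^bsub>G\<^esub> (inv\<^bsub>G\<^esub> h \<otimes>\<^bsub>G\<^esub> g))
          = b (inv\<^bsub>G\<^esub> h \<otimes>\<^bsub>G\<^esub> k) \<otimes>\<^bsub>R\<^esub> c (inv\<^bsub>G\<^esub> k \<otimes>\<^bsub>G\<^esub> g)" by simp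
      qed (use abc g Kc hG in \<open>auto simp: cl\<close>)
      finally have e: "(b \<otimes>\<^bsub>group_ring R G\<^esub> c) (inv\<^bsub>G\<^esub> h \<otimes>\<^bsub>G\<^esub> g) = \<dots>" .
      show "(\<Oplus>\<^bsub>R\<^esub>k\<in>K. a h \<otimes>\<^bsub>R\<^esub> (b (inv\<^bsub>G\<^esub> h \<otimes>\<^bsub>G\<^esub> k) \<otimes>\<^bsub>R\<^esub> c (inv\<^bsub>G\<^esub> k \<otimes>\<^bsub>G\<^esub> g)))
        = a h \<otimes>\<^bsub>R\<^esub> (b \<otimes>\<^bsub>group_ring R G\<^esub> c) (inv\<^bsub>G\<^esub> h \<otimes>\<^bsub>G\<^esub> g)"
        unfolding e by (rule R.finsum_rdistr[symmetric]) (use abc g Kc hG K in \<open>auto simp: cl\<close>)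
    qed (use abc g mcl in \<open>auto simp: cl\<close>)
    also have "\<dots> = (a \<otimes>\<^bsub>group_ring R G\<^esub> (b \<otimes>\<^bsub>group_ring R G\<^esub> c)) g"
      by (rule conv[symmetric]) (use abc g mcl fa in auto)
    finally show "(a \<otimes>\<^bsub>group_ring R G\<^esub> b \<otimes>\<^bsub>group_ring R G\<^esub> c) g = (a \<otimes>\<^bsub>group_ring R G\<^esub> (b \<otimes>\<^bsub>group_ring R G\<^esub> c)) g" .
  qed (use abc mcl in auto)
  have lone: "\<one>\<^bsub>group_ring R G\<^esub> \<otimes>\<^bsub>group_ring R G\<^esub> a = a" if a: "a \<in> ?C" for a
  proof (rule ext)
    fix g assume g: "g \<in> carrier G"
    have "(\<one>\<^bsub>group_ring R G\<^esub> \<otimes>\<^bsub>group_ring R G\<^esub> a) g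
      = (\<Oplus>\<^bsub>R\<^esub>h\<in>{\<one>\<^bsub>G\<^esub>}. \<one>\<^bsub>group_ring R G\<^esub> h \<otimes>\<^bsub>R\<^esub> a (inv\<^bsub>G\<^esub> h \<otimes>\<^bsub>G\<^esub> g))"
      by (rule conv) (use a g ocl one in \<open>auto split: if_splits\<close>)
    also have "\<dots> = a g" using a g by (simp add: one cl)
    finally show "(\<one>\<^bsub>group_ring R G\<^esub> \<otimes>\<^bsub>group_ring R G\<^esub> a) g = a g" .
  qed (use a mcl ocl in auto)
  have rone: "a \<otimes>\<^bsub>group_ring R G\<^esub> \<one>\<^bsub>group_ring R G\<^esub> = a" if a: "a \<in> ?C" for a
  proof (rule ext)
    fix g assume g: "g \<in> carrier G"
    have fa: "finite (insert g (?S a))" using a by (simp add: C)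
    have u: "inv\<^bsub>G\<^esub> h \<otimes>\<^bsub>G\<^esub> g = \<one>\<^bsub>G\<^esub> \<longleftrightarrow> g = h" if "h \<in> carrier G" for h
    proof
      assume "inv\<^bsub>G\<^esub> h \<otimes>\<^bsub>G\<^esub> g = \<one>\<^bsub>G\<^esub>"
      then have "inv\<^bsub>G\<^esub> h \<otimes>\<^bsub>G\<^esub> g = inv\<^bsub>G\<^esub> h \<otimes>\<^bsub>G\<^esub> h" using that by simp
      then show "g = h" using that g by (metis G.inv_closed G.l_cancel)
    qed (use that in simp)
    have "(a \<otimes>\<^bsub>group_ring R G\<^esub> \<one>\<^bsub>group_ring R G\<^esub>) g
      = (\<Oplus>\<^bsub>R\<^esub>h\<in>insert g (?S a). a h \<otimes>\<^bsub>R\<^esub> \<one>\<^bsub>group_ring R G\<^esub> (inv\<^bsub>G\<^esub> h \<otimes>\<^bsub>G\<^esub> g))"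
      by (rule conv) (use a g ocl fa in auto)
    also have "\<dots> = (\<Oplus>\<^bsub>R\<^esub>h\<in>insert g (?S a). if g = h then a h else \<zero>\<^bsub>R\<^esub>)"
      using a g by (intro R.finsum_cong') (auto simp: one u cl)
    also have "\<dots> = a g"
      by (rule R.finsum_singleton) (use a g fa in \<open>auto simp: cl\<close>)
    finally show "(a \<otimes>\<^bsub>group_ring R G\<^esub> \<one>\<^bsub>group_ring R G\<^esub>) g = a g" .
  qed (use a mcl ocl in auto)
  have "abelian_group (group_ring R G)"
  proof (rule abelian_groupI)
    fix x assume x: "x \<in> ?C"
    let ?y = "\<lambda>g\<in>carrier G. \<ominus>\<^bsub>R\<^esub> x g"
    have "?S ?y \<subseteq> ?S x" using x by (auto simp: cl)
    then have "finite (?S ?y)" by (rule finite_subset) (use x in \<open>simp add: C\<close>)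
    moreover have "?y \<in> carrier G \<rightarrow>\<^sub>E carrier R" using x by (auto simp: cl)
    ultimately have y: "?y \<in> ?C" by (simp only: C)
    moreover have "?y \<oplus>\<^bsub>group_ring R G\<^esub> x = \<zero>\<^bsub>group_ring R G\<^esub>"
      by (rule ext) (use x y acl zcl in \<open>auto simp: add zero cl R.l_neg\<close>)
    ultimately show "\<exists>y\<in>?C. y \<oplus>\<^bsub>group_ring R G\<^esub> x = \<zero>\<^bsub>group_ring R G\<^esub>" by blast
  next
    fix x y z assume "x \<in> ?C" "y \<in> ?C" "z \<in> ?C"
    then show "x \<oplus>\<^bsub>group_ring R G\<^esub> y \<oplus>\<^bsub>group_ring R G\<^esub> z = x \<oplus>\<^bsub>group_ring R G\<^esub> (y \<oplus>\<^bsub>group_ring R G\<^esub> z)"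
      by (intro ext) (auto simp: add cl acl R.a_assoc)
  next
    fix x y assume "x \<in> ?C" "y \<in> ?C"
    then show "x \<oplus>\<^bsub>group_ring R G\<^esub> y = y \<oplus>\<^bsub>group_ring R G\<^esub> x"
      by (intro ext) (auto simp: add cl acl R.a_comm)
  next
    fix x assume "x \<in> ?C"
    then show "\<zero>\<^bsub>group_ring R G\<^esub> \<oplus>\<^bsub>group_ring R G\<^esub> x = x"
      by (intro ext) (auto simp: add zero cl acl zcl)
  qed (use acl zcl in auto)
  moreover have "monoid (group_ring R G)"
    by (rule monoidI) (use mcl ocl assoc lone rone in auto)
  moreover have "(x \<oplus>\<^bsub>group_ring R G\<^esub> y) \<otimes>\<^bsub>group_ring R G\<^esub> z
      = x \<otimes>\<^bsub>group_ring R G\<^esub> z \<oplus>\<^bsub>group_ring R G\<^esub> y \<otimes>\<^bsub>group_ring R G\<^esub> z"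
    if xyz: "x \<in> ?C" "y \<in> ?C" "z \<in> ?C" for x y z
  proof (rule ext)
    fix g assume g: "g \<in> carrier G"
    let ?F = "?S x \<union> ?S y"
    have F: "finite ?F" "?F \<subseteq> carrier G" using xyz by (auto simp: C)
    have "((x \<oplus>\<^bsub>group_ring R G\<^esub> y) \<otimes>\<^bsub>group_ring R G\<^esub> z) g
      = (\<Oplus>\<^bsub>R\<^esub>h\<in>?F. (x \<oplus>\<^bsub>group_ring R G\<^esub> y) h \<otimes>\<^bsub>R\<^esub> z (inv\<^bsub>G\<^esub> h \<otimes>\<^bsub>G\<^esub> g))"
      by (rule conv[OF acl[OF xyz(1,2)] xyz(3) g F(1) _ F(2)]) (auto simp: add)
    also have "\<dots> = (\<Oplus>\<^bsub>R\<^esub>h\<in>?F. x h \<otimes>\<^bsub>R\<^esub> z (inv\<^bsub>G\<^esub> h \<otimes>\<^bsub>G\<^esub> g) \<oplus>\<^bsub>R\<^esub> y h \<otimes>\<^bsub>R\<^esub> z (inv\<^bsub>G\<^esub> h \<otimes>\<^bsub>G\<^esub> g))"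
      using xyz g by (intro R.finsum_cong') (auto simp: add cl R.l_distr)
    also have "\<dots> = (\<Oplus>\<^bsub>R\<^esub>h\<in>?F. x h \<otimes>\<^bsub>R\<^esub> z (inv\<^bsub>G\<^esub> h \<otimes>\<^bsub>G\<^esub> g)) \<oplus>\<^bsub>R\<^esub> (\<Oplus>\<^bsub>R\<^esub>h\<in>?F. y h \<otimes>\<^bsub>R\<^esub> z (inv\<^bsub>G\<^esub> h \<otimes>\<^bsub>G\<^esub> g))"
      using xyz g by (intro R.finsum_addf) (auto simp: cl)
    also have "\<dots> = (x \<otimes>\<^bsub>group_ring R G\<^esub> z) g \<oplus>\<^bsub>R\<^esub> (y \<otimes>\<^bsub>group_ring R G\<^esub> z) g"
      using conv[OF xyz(1,3) g F(1) _ F(2)] conv[OF xyz(2,3) g F(1) _ F(2)] by simp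
    also have "\<dots> = (x \<otimes>\<^bsub>group_ring R G\<^esub> z \<oplus>\<^bsub>group_ring R G\<^esub> y \<otimes>\<^bsub>group_ring R G\<^esub> z) g"
      using g by (simp add: add)
    finally show "((x \<oplus>\<^bsub>group_ring R G\<^esub> y) \<otimes>\<^bsub>group_ring R G\<^esub> z) g = \<dots>" .
  qed (use xyz mcl acl in auto)
  moreover have "z \<otimes>\<^bsub>group_ring R G\<^esub> (x \<oplus>\<^bsub>group_ring R G\<^esub> y)
      = z \<otimes>\<^bsub>group_ring R G\<^esub> x \<oplus>\<^bsub>group_ring R G\<^esub> z \<otimes>\<^bsub>group_ring R G\<^esub> y"
    if xyz: "x \<in> ?C" "y \<in> ?C" "z \<in> ?C" for x y z
  proof (rule ext)
    fix g assume g: "g \<in> carrier G"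
    let ?F = "?S z"
    have "(z \<otimes>\<^bsub>group_ring R G\<^esub> (x \<oplus>\<^bsub>group_ring R G\<^esub> y)) g
      = (\<Oplus>\<^bsub>R\<^esub>h\<in>?F. z h \<otimes>\<^bsub>R\<^esub> (x \<oplus>\<^bsub>group_ring R G\<^esub> y) (inv\<^bsub>G\<^esub> h \<otimes>\<^bsub>G\<^esub> g))"
      using g by (simp add: group_ring_def)
    also have "\<dots> = (\<Oplus>\<^bsub>R\<^esub>h\<in>?F. z h \<otimes>\<^bsub>R\<^esub> x (inv\<^bsub>G\<^esub> h \<otimes>\<^bsub>G\<^esub> g) \<oplus>\<^bsub>R\<^esub> z h \<otimes>\<^bsub>R\<^esub> y (inv\<^bsub>G\<^esub> h \<otimes>\<^bsub>G\<^esub> g))"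
      using xyz g by (intro R.finsum_cong') (auto simp: add cl R.r_distr)
    also have "\<dots> = (\<Oplus>\<^bsub>R\<^esub>h\<in>?F. z h \<otimes>\<^bsub>R\<^esub> x (inv\<^bsub>G\<^esub> h \<otimes>\<^bsub>G\<^esub> g)) \<oplus>\<^bsub>R\<^esub> (\<Oplus>\<^bsub>R\<^esub>h\<in>?F. z h \<otimes>\<^bsub>R\<^esub> y (inv\<^bsub>G\<^esub> h \<otimes>\<^bsub>G\<^esub> g))"
      using xyz g by (intro R.finsum_addf) (auto simp: cl)
    also have "\<dots> = (z \<otimes>\<^bsub>group_ring R G\<^esub> x \<oplus>\<^bsub>group_ring R G\<^esub> z \<otimes>\<^bsub>group_ring R G\<^esub> y) g"
      using g by (simp add: group_ring_def)
    finally show "(z \<otimes>\<^bsub>group_ring R G\<^esub> (x \<oplus>\<^bsub>group_ring R G\<^esub> y)) g = \<dots>" .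
  qed (use xyz mcl acl in auto)
  ultimately show ?thesis by (intro ringI) auto
qed

end

theory Submission
  imports Defs
begin

text \<open>
  Let \<open>\<epsilon>: RG \<rightarrow> R\<close> be the augmentation, which is split by \<open>R \<subseteq> RG\<close>.

  For (1), the kernel of \<open>\<epsilon>\<close> is nil: an element of it is supported on a finite \<open>p\<close>-group \<open>H\<close>, and
  the augmentation ideal of \<open>H\<close> acts nilpotently because a finite \<open>p\<close>-group acting on a nonzero module
  on which \<open>p\<close> is nilpotent fixes a nonzero vector. Hence units and the Jacobson radical lift
  along \<open>\<epsilon>\<close>. If \<open>\<epsilon>(x) = t + q\<close> with \<open>t\<close> a torsion unit and \<open>q\<close> quasinilpotent, then
  \<open>x = t + (x - t)\<close> is such a decomposition in \<open>RG\<close>.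

  For (2), \<open>R\<close> is central in \<open>RG\<close>, so \<open>\<epsilon>\<close> preserves quasinilpotents and decompositions descend
  to \<open>R\<close>; thus \<open>R\<close> is local and its residue field, whose nonzero elements are roots of unity,
  has prime characteristic \<open>p\<close>. A sum of a torsion unit and a quasinilpotent element has nonzero
  augmentation, so the kernel of \<open>\<epsilon>\<close> lies in the Jacobson radical, and every element of \<open>RG\<close>
  whose augmentation is a unit is itself a unit. If \<open>g\<close> has infinite order this fails for
  \<open>1 - g + g\<^sup>2\<close>, and if \<open>g\<close> has prime order \<open>q \<noteq> p\<close> it fails for the zero divisor
  \<open>1 + g + \<dots> + g\<^bsup>q-1\<^esup>\<close>.
\<close>

section \<open>Finite p-groups\<close>

text \<open>Split off the full power of \<open>p\<close>: a cofactor other than 1 would have a prime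
  divisor, which would again be \<open>p\<close>. It serves both for orders of groups and for orders
  of elements.\<close>

lemma power_of_prime_if_prime_divisors:
  assumes p: "Factorial_Ring.prime (p::nat)" and n: "n > 0"
    and q: "\<And>q. Factorial_Ring.prime q \<Longrightarrow> q dvd n \<Longrightarrow> q = p"
  shows "\<exists>k. n = p ^ k"
proof -
  obtain m where m: "n = p ^ multiplicity p n * m" "\<not> p dvd m"
    using multiplicity_decompose'[of n p] n p by (metis not_prime_unit less_numeral_extra(3))
  have "m = 1"
  proof (rule ccontr)
    assume "m \<noteq> 1"
    then obtain r where r: "Factorial_Ring.prime r" "r dvd m" using prime_factor_nat by blast
    then have "r = p" using q m(1) by (metis dvd_mult)
    with r m(2) show False by simp
  qed
  then show ?thesis using m(1) by auto
qed

text \<open>Sylow's theorem with exponent 1 acts as Cauchy's theorem: a prime \<open>q\<close>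
  dividing the order gives a subgroup of order \<open>q\<close>. A nontrivial element of it has an
  order that divides \<open>q\<close> and is a power of \<open>p\<close>, hence
  \<open>q = p\<close>.\<close>

lemma (in group) p_group_order:
  assumes p: "Factorial_Ring.prime p" and fin: "finite (carrier G)" and G: "p_group p G"
  shows "\<exists>k. order G = p ^ k"
proof (rule power_of_prime_if_prime_divisors[OF p])
  show "order G > 0" using fin by (simp add: order_gt_0_iff_finite)
  fix q assume q: "Factorial_Ring.prime q" "q dvd order G"
  then obtain r where "order G = q ^ 1 * r" by auto
  with sylow_thm[OF q(1) group_axioms] fin obtain K where K: "subgroup K G" "card K = q ^ 1"
    by blast
  interpret K: subgroup K G by fact
  have "K \<noteq> {\<one>}" using K(2) q(1) by auto
  then obtain x where x: "x \<in> K" "x \<noteq> \<one>" using K.one_closed by blast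
  have "x [^] card K = \<one>"
    using group.pow_order_eq_1[OF subgroup_imp_group[OF K(1)], of x] x(1)
    by (simp add: nat_pow_consistent[symmetric] order_def)
  then have "ord x dvd q" using pow_eq_id[of x q] x K.mem_carrier K(2) by simp
  moreover have "ord x \<noteq> 1" using x K.mem_carrier ord_eq_1 by auto
  moreover obtain k where "ord x = p ^ k" using G x(1) K.mem_carrier unfolding p_group_def by blast
  ultimately have "p dvd q" using p q(1)
    by (metis dvd_power dvd_trans gr0I power_0)
  then show "q = p" using primes_dvd_imp_eq[OF p q(1)] by simp
qed

text \<open>Orbit counting: every orbit has \<open>p\<close>-power size, and only fixed points have
  orbits of size 1. Were \<open>x\<close> the only fixed point, \<open>card E\<close> would be 1
  plus a multiple of \<open>p\<close>.\<close>

lemma (in group_action) p_group_second_fixed_point: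
  assumes p: "Factorial_Ring.prime p" and ord: "order G = p ^ k" and fin: "finite E"
    and dvd: "p dvd card E" and x: "x \<in> E" "\<And>g. g \<in> carrier G \<Longrightarrow> \<phi> g x = x"
  shows "\<exists>y\<in>E. y \<noteq> x \<and> (\<forall>g\<in>carrier G. \<phi> g y = y)"
proof (rule ccontr)
  assume no: "\<not> ?thesis"
  interpret G: group G using group_hom group_hom.axioms(1) by auto
  let ?O = "orbits G E \<phi>"
  have finO: "finite ?O" unfolding orbits_def using fin by simp
  have ox: "orbit G \<phi> x = {x}" unfolding orbit_def using x by (auto intro!: exI[of _ \<one>])
  have xO: "{x} \<in> ?O" unfolding orbits_def using ox x by blast
  have "p dvd card Y" if Y: "Y \<in> ?O - {{x}}" for Y
  proof -
    obtain y where y: "y \<in> E" "Y = orbit G \<phi> y" using Y by (auto simp: orbits_def)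
    have "card Y dvd p ^ k" using orbit_stabilizer_theorem[OF y(1)] ord y(2) by (metis dvd_triv_left)
    then obtain j where j: "card Y = p ^ j" using p by (auto simp: divides_primepow_nat)
    moreover have "j \<noteq> 0"
    proof
      assume "j = 0"
      then have "card Y = 1" using j by simp
      then have Yy: "Y = {y}" using orbit_refl[OF y(1)] y(2) by (metis card_1_singletonE singletonD)
      then have "\<forall>g\<in>carrier G. \<phi> g y = y" using y(2) by (auto simp: orbit_def)
      then have "y = x" using no y(1) by blast
      with Yy Y show False by simp
    qed
    ultimately show ?thesis by simp
  qed
  then have "p dvd (\<Sum>Y\<in>?O - {{x}}. card Y)" by (intro dvd_sum) auto
  moreover have "card E = (\<Sum>Y\<in>?O. card Y)" using disjoint_sum[OF fin, of "\<lambda>_. 1::nat"] by simp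
  moreover have "\<dots> = 1 + (\<Sum>Y\<in>?O - {{x}}. card Y)" using sum.remove[OF finO xO, of card] by simp
  ultimately have "p dvd 1" using dvd by (metis dvd_add_left_iff)
  then show False using p by simp
qed

text \<open>Translation on the right by \<open>inv g\<close> instead of \<open>g\<close> makes
  products of group elements correspond to compositions in the same order. The maps are restricted
  to the cosets because \<open>Bij\<close> consists of extensional functions.\<close>

lemma (in group) rcosets_action:
  assumes N: "subgroup N G"
  shows "group_action G (rcosets N) (\<lambda>g. \<lambda>C\<in>rcosets N. C #> inv g)"
proof -
  have cl: "C #> g \<in> rcosets N" if C: "C \<in> rcosets N" and g: "g \<in> carrier G" for C g
  proof -
    obtain a where a: "a \<in> carrier G" "C = N #> a" using C by (auto simp: RCOSETS_def)
    then have "C #> g = N #> (a \<otimes> g)"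
      using g coset_mult_assoc[OF subgroup.subset[OF N]] by simp
    then show ?thesis using a g by (auto simp: RCOSETS_def)
  qed
  have assoc: "C #> g #> h = C #> (g \<otimes> h)" if "C \<in> rcosets N" "g \<in> carrier G" "h \<in> carrier G" for C g h
    using coset_mult_assoc that subgroup.rcosets_carrier[OF N is_group] by blast
  have one: "C #> \<one> = C" if "C \<in> rcosets N" for C
    using coset_mult_one that subgroup.rcosets_carrier[OF N is_group] by blast
  have bij: "(\<lambda>C\<in>rcosets N. C #> inv g) \<in> Bij (rcosets N)" if g: "g \<in> carrier G" for g
    unfolding Bij_def
  proof (intro IntI CollectI)
    show "bij_betw (\<lambda>C\<in>rcosets N. C #> inv g) (rcosets N) (rcosets N)"
      by (rule bij_betw_byWitness[where f' = "\<lambda>C. C #> g"]) (use g cl assoc one in auto)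
  qed auto
  show ?thesis
  proof (intro group_action.intro group_hom.intro group_hom_axioms.intro is_group group_BijGroup homI)
    fix g assume "g \<in> carrier G"
    then show "(\<lambda>C\<in>rcosets N. C #> inv g) \<in> carrier (BijGroup (rcosets N))"
      using bij by (simp add: BijGroup_def)
  next
    fix g h assume g: "g \<in> carrier G" "h \<in> carrier G"
    then have "(\<lambda>C\<in>rcosets N. C #> inv (g \<otimes> h))
      = compose (rcosets N) (\<lambda>C\<in>rcosets N. C #> inv g) (\<lambda>C\<in>rcosets N. C #> inv h)"
      by (auto simp: compose_def fun_eq_iff inv_mult_group assoc cl)
    then show "(\<lambda>C\<in>rcosets N. C #> inv (g \<otimes> h)) =
      (\<lambda>C\<in>rcosets N. C #> inv g) \<otimes>\<^bsub>BijGroup (rcosets N)\<^esub> (\<lambda>C\<in>rcosets N. C #> inv h)"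
      using g bij by (simp add: BijGroup_def)
  qed
qed

text \<open>\<open>N\<close> acts on its right cosets and fixes the coset \<open>N\<close>. Their
  number is a power of \<open>p\<close> other than 1, so a second coset \<open>N #> a\<close> is
  fixed as well, which says that \<open>inv a\<close> normalizes \<open>N\<close>. A suitable power
  of \<open>inv a\<close> then also has its \<open>p\<close>-th power in \<open>N\<close>.\<close>

lemma (in group) p_group_normalizer_grows:
  assumes p: "Factorial_Ring.prime p" and fin: "finite (carrier G)" and G: "p_group p G"
    and N: "subgroup N G" "N \<noteq> carrier G"
  shows "\<exists>g\<in>carrier G - N. (\<forall>n\<in>N. inv g \<otimes> n \<otimes> g \<in> N) \<and> g [^] p \<in> N"
proof -
  interpret N: subgroup N G by fact
  let ?E = "rcosets N"
  obtain k where k: "order G = p ^ k" using p_group_order[OF p fin G] by blast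
  have finN: "finite N" using fin N.subset finite_subset by blast
  have lag: "card ?E * card N = p ^ k" using lagrange[OF N(1)] k by simp
  then obtain l where l: "card N = p ^ l" using p by (metis divides_primepow_nat dvd_triv_right)
  have finE: "finite ?E" using fin by (metis RCOSETS_def finite_UN_I finite.emptyI finite.insertI)
  have "card ?E \<noteq> 1"
  proof
    assume "card ?E = 1"
    then have "card N = card (carrier G)" using lagrange[OF N(1)] by (simp add: order_def)
    then show False using N fin N.subset card_subset_eq by blast
  qed
  moreover obtain j where "card ?E = p ^ j" using lag p by (metis divides_primepow_nat dvd_triv_left)
  ultimately have pE: "p dvd card ?E" by (metis dvd_power gr0I power_0)
  interpret act: group_action "G\<lparr>carrier := N\<rparr>" ?E "\<lambda>g. \<lambda>C\<in>rcosets N. C #> inv g"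
    using group_action.induced_action[OF rcosets_action[OF N(1)] N(1)] .
  have NE: "N \<in> ?E" using N.subgroup_in_rcosets[OF is_group] .
  have "\<exists>C\<in>?E. C \<noteq> N \<and> (\<forall>n\<in>carrier (G\<lparr>carrier := N\<rparr>). (\<lambda>C\<in>?E. C #> inv n) C = C)"
    by (rule act.p_group_second_fixed_point[OF p _ finE pE NE])
      (use l NE in \<open>auto simp: order_def coset_join2 N(1)\<close>)
  then obtain C where C: "C \<in> ?E" "C \<noteq> N" "\<And>n. n \<in> N \<Longrightarrow> C #> inv n = C" by auto
  then obtain a where a: "a \<in> carrier G" "C = N #> a" by (auto simp: RCOSETS_def)
  have aN: "a \<notin> N" using C(2) a coset_join2[OF _ N(1)] by blast
  have conj: "a \<otimes> n \<otimes> inv a \<in> N" if n: "n \<in> N" for n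
  proof -
    have "C #> n = C" using C(3)[of "inv n"] n by simp
    then have "N #> (a \<otimes> n) = N #> a" using a n coset_mult_assoc[OF N.subset] by simp
    then have "a \<otimes> n \<in> N #> a" using a n rcos_self[OF _ N(1)] by (metis N.mem_carrier m_closed)
    then show ?thesis using a n by (metis N.rcos_module_imp is_group)
  qed
  let ?g = "inv a"
  let ?P = "\<lambda>g. \<forall>n\<in>N. inv g \<otimes> n \<otimes> g \<in> N"
  \<comment> \<open>The element finally chosen is a power of \<open>?g\<close>, so normalization of
    \<open>N\<close> is passed to all powers.\<close>
  have pow: "?P (?g [^] (i::nat))" for i
  proof (induction i)
    case 0 then show ?case by simp
  next
    case (Suc i)
    show ?case
    proof
      fix n assume n: "n \<in> N"
      let ?h = "?g [^] i"
      have "inv (?g [^] Suc i) \<otimes> n \<otimes> ?g [^] Suc i = a \<otimes> (inv ?h \<otimes> n \<otimes> ?h) \<otimes> inv a"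
        using a n by (simp add: inv_mult_group m_assoc)
      then show "inv (?g [^] Suc i) \<otimes> n \<otimes> ?g [^] Suc i \<in> N" using Suc n conj by simp
    qed
  qed
  \<comment> \<open>Among the iterated \<open>p\<close>-th powers of \<open>?g\<close>, take the
    last one outside \<open>N\<close>, just before the least exponent for which membership
    holds.\<close>
  let ?Q = "\<lambda>j. ?g [^] (p ^ j) \<in> N"
  obtain e where "ord ?g = p ^ e" using G a by (auto simp: p_group_def)
  then have "?Q e" using pow_ord_eq_1[of ?g] a by simp
  then have Q: "?Q (Least ?Q)" by (rule LeastI)
  have "Least ?Q \<noteq> 0"
  proof
    assume "Least ?Q = 0"
    then have "?g \<in> N" using Q a by simp
    then have "inv ?g \<in> N" by blast
    then show False using a aN by simp
  qed
  then obtain j where j: "Least ?Q = Suc j" using not0_implies_Suc by blast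
  then have "\<not> ?Q j" using not_less_Least[of j ?Q] by simp
  moreover have "(?g [^] (p ^ j)) [^] p \<in> N"
    using Q j a by (simp add: nat_pow_pow mult.commute)
  ultimately show ?thesis using a pow by (intro bexI[of _ "?g [^] (p ^ j)"]) auto
qed

lemma (in group) p_group_subgroup:
  assumes H: "subgroup H G" and "p_group p G"
  shows "p_group p (G\<lparr>carrier := H\<rparr>)"
proof -
  interpret H: group "G\<lparr>carrier := H\<rparr>" by (rule subgroup_imp_group[OF H])
  have "H.ord h = ord h" for h
    unfolding ord_def H.ord_def by (simp add: nat_pow_consistent[symmetric])
  then show ?thesis using assms(2) subgroup.mem_carrier[OF H] by (simp add: p_group_def)
qed

section \<open>The Jacobson radical and quasinilpotent elements\<close>

text \<open>\<open>P\<close> stands for the side conditions that an application of Zorn's lemma puts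
  on its left ideals. Closure under addition holds because two members of a chain are
  comparable.\<close>

lemma (in ring) left_ideal_union_chain:
  assumes ne: "\<C> \<noteq> {}" and ch: "subset.chain {I. left_ideal I R \<and> P I} \<C>"
  shows "left_ideal (\<Union>\<C>) R"
proof -
  have L: "\<And>I. I \<in> \<C> \<Longrightarrow> left_ideal I R" and
    tot: "\<And>I J. I \<in> \<C> \<Longrightarrow> J \<in> \<C> \<Longrightarrow> I \<subseteq> J \<or> J \<subseteq> I"
    using ch unfolding subset_chain_def by blast+
  have A: "\<And>I. I \<in> \<C> \<Longrightarrow> additive_subgroup I R" using L by (simp add: left_ideal_def)
  have "subgroup (\<Union>\<C>) (add_monoid R)"
  proof (rule add.subgroupI)
    show "\<Union>\<C> \<subseteq> carrier R" using A additive_subgroup.a_subset by blast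
    show "\<Union>\<C> \<noteq> {}" using ne A additive_subgroup.zero_closed by blast
  next
    fix a assume "a \<in> \<Union>\<C>"
    then show "\<ominus> a \<in> \<Union>\<C>" using A by (metis UnionE UnionI additive_subgroup.a_inv_closed)
  next
    fix a b assume "a \<in> \<Union>\<C>" "b \<in> \<Union>\<C>"
    then obtain I where "I \<in> \<C>" "a \<in> I" "b \<in> I" using tot by blast
    then show "a \<oplus> b \<in> \<Union>\<C>" using A by (meson UnionI additive_subgroup.a_closed)
  qed
  moreover have "\<forall>x\<in>carrier R. \<forall>a\<in>\<Union>\<C>. x \<otimes> a \<in> \<Union>\<C>" using L unfolding left_ideal_def by blast
  ultimately show ?thesis unfolding left_ideal_def additive_subgroup_def by blast
qed

lemma (in ring) left_ideal_one_imp_carrier: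
  assumes K: "left_ideal K R" "\<one> \<in> K" shows "K = carrier R"
proof
  show "K \<subseteq> carrier R" using K by (auto simp: left_ideal_def dest: additive_subgroup.a_subset)
  show "carrier R \<subseteq> K"
  proof
    fix x assume x: "x \<in> carrier R"
    then have "x \<otimes> \<one> \<in> K" using K unfolding left_ideal_def by blast
    then show "x \<in> K" using x by simp
  qed
qed

text \<open>Zorn's lemma, with properness expressed by \<open>\<one> \<notin> K\<close>, a condition
  that survives unions of chains.\<close>

lemma (in ring) proper_left_ideal_in_maximal:
  assumes I: "left_ideal I R" "\<one> \<notin> I"
  shows "\<exists>M. maximal_left_ideal M R \<and> I \<subseteq> M"
proof -
  let ?A = "{K. left_ideal K R \<and> (I \<subseteq> K \<and> \<one> \<notin> K)}"
  obtain M where "M \<in> ?A" "\<forall>K\<in>?A. M \<subseteq> K \<longrightarrow> K = M"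
  proof (rule bexE[OF subset_Zorn_nonempty[of ?A]])
    show "?A \<noteq> {}" using I by blast
    fix \<C> assume C: "\<C> \<noteq> {}" "subset.chain ?A \<C>"
    then have "\<And>K. K \<in> \<C> \<Longrightarrow> I \<subseteq> K \<and> \<one> \<notin> K" by (auto simp: subset.chain_def)
    then show "\<Union>\<C> \<in> ?A" using C left_ideal_union_chain[OF C] by blast
  qed
  then have "left_ideal M R" "I \<subseteq> M" "\<one> \<notin> M"
    "\<And>K. left_ideal K R \<Longrightarrow> \<one> \<notin> K \<Longrightarrow> M \<subseteq> K \<Longrightarrow> K = M" by blast+
  note M = this
  then have "maximal_left_ideal M R" unfolding maximal_left_ideal_def
    using left_ideal_one_imp_carrier by blast
  then show ?thesis using M by blast
qed

lemma (in ring) left_ideal_right_multiples: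
  assumes u: "u \<in> carrier R"
  shows "left_ideal {a \<otimes> u | a. a \<in> carrier R} R"
  unfolding left_ideal_def additive_subgroup_def
proof (intro conjI ballI add.subgroupI)
  fix a b assume a: "a \<in> {a \<otimes> u | a. a \<in> carrier R}"
  then obtain x where x: "x \<in> carrier R" "a = x \<otimes> u" by blast
  then have "\<ominus> a = (\<ominus> x) \<otimes> u" using u by (simp add: l_minus)
  then show "\<ominus> a \<in> {a \<otimes> u | a. a \<in> carrier R}" using x by blast
  assume "b \<in> {a \<otimes> u | a. a \<in> carrier R}"
  then obtain y where y: "y \<in> carrier R" "b = y \<otimes> u" by blast
  then have "a \<oplus> b = (x \<oplus> y) \<otimes> u" using x u by (simp add: l_distr)
  then show "a \<oplus> b \<in> {a \<otimes> u | a. a \<in> carrier R}" using x y by blast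
next
  fix x a assume "x \<in> carrier R" "a \<in> {a \<otimes> u | a. a \<in> carrier R}"
  then obtain y where y: "y \<in> carrier R" "x \<in> carrier R" "a = y \<otimes> u" by blast
  then have "x \<otimes> a = (x \<otimes> y) \<otimes> u" using u by (simp add: m_assoc)
  then show "x \<otimes> a \<in> {a \<otimes> u | a. a \<in> carrier R}" using y by blast
qed (use u in auto)

lemma (in ring) left_ideal_jacobson_radical: "left_ideal (jacobson_radical R) R"
  unfolding left_ideal_def additive_subgroup_def
proof (intro conjI ballI add.subgroupI)
  have "\<zero> \<in> jacobson_radical R"
    by (auto simp: jacobson_radical_def maximal_left_ideal_def left_ideal_def
        intro: additive_subgroup.zero_closed)
  then show "jacobson_radical R \<noteq> {}" by blast
qed (auto simp: jacobson_radical_def maximal_left_ideal_def left_ideal_def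
      intro: additive_subgroup.a_closed additive_subgroup.a_inv_closed)

lemma (in ring) jacobson_left_mult:
  "a \<in> carrier R \<Longrightarrow> x \<in> jacobson_radical R \<Longrightarrow> a \<otimes> x \<in> jacobson_radical R"
  using left_ideal_jacobson_radical by (simp add: left_ideal_def)

lemma (in ring) jacobson_additive: "additive_subgroup (jacobson_radical R) R"
  using left_ideal_jacobson_radical by (simp add: left_ideal_def)

lemma (in ring) jacobson_subset: "jacobson_radical R \<subseteq> carrier R"
  by (auto simp: jacobson_radical_def)

text \<open>Without a left inverse, the left ideal generated by \<open>\<one> \<oplus> x\<close>
  lies in a maximal one. That ideal contains \<open>x\<close> too, hence 1.\<close>

lemma (in ring) one_plus_jacobson_left_inverse:
  assumes x: "x \<in> jacobson_radical R"
  shows "\<exists>b\<in>carrier R. b \<otimes> (\<one> \<oplus> x) = \<one>"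
proof (rule ccontr)
  assume no: "\<not> ?thesis"
  have xc: "x \<in> carrier R" using x jacobson_subset by blast
  let ?I = "{a \<otimes> (\<one> \<oplus> x) | a. a \<in> carrier R}"
  have "\<one> \<notin> ?I" using no by force
  then obtain M where M: "maximal_left_ideal M R" "?I \<subseteq> M"
    using proper_left_ideal_in_maximal[OF left_ideal_right_multiples] xc by blast
  then have L: "left_ideal M R" by (simp add: maximal_left_ideal_def)
  then interpret M: additive_subgroup M R by (simp add: left_ideal_def)
  have "\<one> \<otimes> (\<one> \<oplus> x) \<in> M" using M(2) by blast
  moreover have xM: "\<ominus> x \<in> M" using x M(1) M.a_inv_closed
    by (auto simp: jacobson_radical_def)
  ultimately have "(\<one> \<oplus> x) \<oplus> \<ominus> x \<in> M" using xc M.a_closed[of "\<one> \<oplus> x" "\<ominus> x"] by simp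
  then have "\<one> \<in> M" using xc by (simp add: a_assoc r_neg)
  then show False
    using M left_ideal_one_imp_carrier by (auto simp: maximal_left_ideal_def)
qed

text \<open>A left inverse \<open>b\<close> equals \<open>1 - b x\<close>, which is again 1 plus a
  radical element, so \<open>b\<close> has a left inverse \<open>c\<close> of its own. As
  \<open>b\<close> is invertible from both sides, \<open>c\<close> equals
  \<open>\<one> \<oplus> x\<close>.\<close>

lemma (in ring) one_plus_jacobson_unit:
  assumes x: "x \<in> jacobson_radical R"
  shows "\<one> \<oplus> x \<in> Units R"
proof -
  have xc: "x \<in> carrier R" using x jacobson_subset by blast
  obtain b where b: "b \<in> carrier R" "b \<otimes> (\<one> \<oplus> x) = \<one>"
    using one_plus_jacobson_left_inverse[OF x] by blast
  have "b \<oplus> b \<otimes> x = \<one>" using b xc by (simp add: r_distr)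
  then have "\<one> \<oplus> (\<ominus> b) \<otimes> x = b" using b xc
    by (metis a_assoc l_minus m_closed r_neg r_zero a_inv_closed)
  then obtain c where c: "c \<in> carrier R" "c \<otimes> b = \<one>"
    using one_plus_jacobson_left_inverse[OF jacobson_left_mult[OF _ x, of "\<ominus> b"]] b by auto
  have "c = \<one> \<oplus> x" using b c xc by (metis a_closed m_assoc one_closed l_one r_one)
  then show ?thesis using b c xc by (auto simp: Units_def)
qed

lemma (in ring) one_minus_jacobson_unit:
  assumes "x \<in> jacobson_radical R" shows "\<one> \<ominus> x \<in> Units R"
proof -
  have "\<ominus> x \<in> jacobson_radical R"
    by (rule additive_subgroup.a_inv_closed[OF jacobson_additive assms])
  then show ?thesis using one_plus_jacobson_unit by (simp add: minus_eq)
qed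

text \<open>If a maximal left ideal \<open>M\<close> misses \<open>x\<close>, then \<open>M\<close>
  and the left multiples of \<open>x\<close> together span the ring. Writing
  \<open>1 = m + a x\<close> shows that the unit \<open>1 - a x\<close> equals \<open>m\<close> and
  lies in \<open>M\<close>.\<close>

lemma (in ring) one_minus_multiples_units_imp_jacobson:
  assumes x: "x \<in> carrier R" and u: "\<And>a. a \<in> carrier R \<Longrightarrow> \<one> \<ominus> a \<otimes> x \<in> Units R"
  shows "x \<in> jacobson_radical R"
  unfolding jacobson_radical_def
proof (intro CollectI conjI allI impI)
  fix M assume M: "maximal_left_ideal M R"
  then have L: "left_ideal M R" by (simp add: maximal_left_ideal_def)
  interpret M: additive_subgroup M R using L by (simp add: left_ideal_def)
  show "x \<in> M"
  proof (rule ccontr)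
    assume xM: "x \<notin> M"
    let ?X = "{a \<otimes> x | a. a \<in> carrier R}"
    have X: "additive_subgroup ?X R"
      using left_ideal_right_multiples[OF x] by (simp add: left_ideal_def)
    let ?K = "M <+>\<^bsub>R\<^esub> ?X"
    have Kmem: "m \<oplus> a \<otimes> x \<in> ?K" if "m \<in> M" "a \<in> carrier R" for m a
      using that unfolding set_add_def' by blast
    have K: "left_ideal ?K R"
      unfolding left_ideal_def
    proof (intro conjI ballI)
      show "additive_subgroup ?K R"
        using add_additive_subgroups M.is_additive_subgroup X by blast
      fix r k assume r: "r \<in> carrier R" and "k \<in> ?K"
      then obtain m a where m: "m \<in> M" "a \<in> carrier R" "k = m \<oplus> a \<otimes> x"
        unfolding set_add_def' by blast
      have "r \<otimes> k = r \<otimes> m \<oplus> r \<otimes> (a \<otimes> x)"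
        unfolding m(3) using r x m(2) M.a_Hcarr[OF m(1)] by (intro r_distr) auto
      then have "r \<otimes> k = r \<otimes> m \<oplus> (r \<otimes> a) \<otimes> x" using r x m(2) m_assoc by metis
      moreover have "r \<otimes> m \<in> M" using L r m by (simp add: left_ideal_def)
      ultimately show "r \<otimes> k \<in> ?K" using m_closed[OF r m(2)] by (simp only: Kmem)
    qed
    have "M \<subseteq> ?K"
    proof
      fix m assume m: "m \<in> M"
      then have "m = m \<oplus> \<zero> \<otimes> x" using x M.a_Hcarr by simp
      then show "m \<in> ?K" using Kmem[OF m zero_closed] by simp
    qed
    moreover have "x \<in> ?K"
    proof -
      have "x = \<zero> \<oplus> \<one> \<otimes> x" using x by simp
      then show ?thesis using Kmem[OF M.zero_closed one_closed] by simp
    qed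
    ultimately have "?K = carrier R" using M K xM by (auto simp: maximal_left_ideal_def)
    then have "\<one> \<in> ?K" by simp
    then obtain m a where m: "m \<in> M" "a \<in> carrier R" "\<one> = m \<oplus> a \<otimes> x"
      unfolding set_add_def' by blast
    then have "m = \<one> \<ominus> a \<otimes> x" using x M.a_subset
      by (metis M.a_Hcarr add.inv_solve_right' m_closed minus_eq one_closed)
    then have "m \<in> Units R" using u[OF m(2)] by metis
    then have inv: "inv m \<in> carrier R" "inv m \<otimes> m = \<one>" by auto
    then have "\<one> \<in> M" using L m(1) by (metis left_ideal_def)
    then show False
      using M left_ideal_one_imp_carrier by (auto simp: maximal_left_ideal_def)
  qed
qed (fact x)

lemma (in ring) unit_plus_jacobson:
  assumes u: "u \<in> Units R" and x: "x \<in> jacobson_radical R"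
  shows "u \<oplus> x \<in> Units R"
proof -
  have "\<one> \<oplus> inv u \<otimes> x \<in> Units R" using u x by (intro one_plus_jacobson_unit jacobson_left_mult) auto
  then have "u \<otimes> (\<one> \<oplus> inv u \<otimes> x) \<in> Units R" using u by simp
  moreover have "u \<otimes> (\<one> \<oplus> inv u \<otimes> x) = u \<oplus> x"
  proof -
    have xc: "x \<in> carrier R" using x jacobson_subset by blast
    have "u \<otimes> (inv u \<otimes> x) = x" using u xc by (simp add: m_assoc[symmetric] Units_closed)
    then show ?thesis using u xc by (simp add: r_distr Units_closed)
  qed
  ultimately show ?thesis by simp
qed

section \<open>Sums of units and quasinilpotent elements\<close>

lemma (in ring) unit_not_quasinilpotent:
  assumes "\<one> \<noteq> \<zero>" "q \<in> Units R" shows "q \<notin> quasinilpotents R"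
proof
  assume "q \<in> quasinilpotents R"
  \<comment> \<open>The inverse of \<open>q\<close> commutes with \<open>q\<close>, and for it the
    element required to be a unit is 0.\<close>
  then have "inv q \<otimes> q = q \<otimes> inv q \<longrightarrow> \<one> \<ominus> inv q \<otimes> q \<in> Units R"
    using assms(2) unfolding quasinilpotents_def by blast
  then have "\<zero> \<in> Units R" using assms by (simp add: minus_eq r_neg)
  then show False using assms by (metis Units_l_inv Units_inv_closed r_null)
qed

text \<open>Otherwise \<open>q = -u + (u + q)\<close> would be a unit plus a radical element, hence
  a unit. This is the half of the defining equality that holds in every nonzero ring.\<close>

lemma (in ring) unit_plus_quasinilpotent_not_jacobson:
  assumes one: "\<one> \<noteq> \<zero>" and u: "u \<in> Units R" and q: "q \<in> quasinilpotents R"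
  shows "u \<oplus> q \<notin> jacobson_radical R"
proof
  assume j: "u \<oplus> q \<in> jacobson_radical R"
  have qc: "q \<in> carrier R" using q by (simp add: quasinilpotents_def)
  have "\<ominus> u \<in> Units R"
  proof -
    have "\<ominus> u \<otimes> \<ominus> (inv u) = \<one>" "\<ominus> (inv u) \<otimes> \<ominus> u = \<one>" using u by (auto simp: l_minus r_minus Units_closed)
    moreover have "\<ominus> u \<in> carrier R" "\<ominus> (inv u) \<in> carrier R" using u by (auto simp: Units_closed)
    ultimately show ?thesis unfolding Units_def by blast
  qed
  then have "\<ominus> u \<oplus> (u \<oplus> q) \<in> Units R" using j by (rule unit_plus_jacobson)
  then have "q \<in> Units R" using u qc by (simp add: a_assoc[symmetric] l_neg Units_closed)
  then show False using unit_not_quasinilpotent one q by blast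
qed

text \<open>In a nonzero ring only the existence of decompositions remains to be checked.
  Conversely, the equality of sets puts \<open>1 = 1 + 0\<close> outside the radical, while 0 lies
  inside it.\<close>

lemma (in ring) generalized_quasi_t_fine_iff:
  "generalized_quasi_t_fine R \<longleftrightarrow> \<one> \<noteq> \<zero> \<and>
    (\<forall>x\<in>carrier R - jacobson_radical R. \<exists>t\<in>torsion_units R. \<exists>q\<in>quasinilpotents R. x = t \<oplus> q)"
proof
  assume g: "generalized_quasi_t_fine R"
  have "\<one> \<in> torsion_units R" "\<zero> \<in> quasinilpotents R"
    by (auto simp: torsion_units_def quasinilpotents_def minus_eq intro!: exI[of _ 1])
  then have "\<one> \<oplus> \<zero> \<in> carrier R - jacobson_radical R"
    using g unfolding generalized_quasi_t_fine_def set_add_def' by blast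
  then have "\<one> \<noteq> \<zero>" using additive_subgroup.zero_closed[OF jacobson_additive] by auto
  then show "\<one> \<noteq> \<zero> \<and>
    (\<forall>x\<in>carrier R - jacobson_radical R. \<exists>t\<in>torsion_units R. \<exists>q\<in>quasinilpotents R. x = t \<oplus> q)"
    using g unfolding generalized_quasi_t_fine_def set_add_def' by blast
next
  assume r: "\<one> \<noteq> \<zero> \<and>
    (\<forall>x\<in>carrier R - jacobson_radical R. \<exists>t\<in>torsion_units R. \<exists>q\<in>quasinilpotents R. x = t \<oplus> q)"
  have "t \<oplus> q \<in> carrier R - jacobson_radical R"
    if "t \<in> torsion_units R" "q \<in> quasinilpotents R" for t q
    using that unit_plus_quasinilpotent_not_jacobson[of t q] r
    by (auto simp: torsion_units_def quasinilpotents_def)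
  with r show "generalized_quasi_t_fine R"
    unfolding generalized_quasi_t_fine_def set_add_def' by blast
qed

text \<open>When everything commutes, the definition of a quasinilpotent element is exactly the unit
  criterion for the radical.\<close>

lemma (in cring) quasinilpotents_eq_jacobson: "quasinilpotents R = jacobson_radical R"
proof
  show "quasinilpotents R \<subseteq> jacobson_radical R"
    unfolding quasinilpotents_def using one_minus_multiples_units_imp_jacobson m_comm by blast
  show "jacobson_radical R \<subseteq> quasinilpotents R"
    unfolding quasinilpotents_def
    using jacobson_subset one_minus_jacobson_unit jacobson_left_mult by blast
qed

section \<open>Transfer of units, radical and decompositions along ring homomorphisms\<close>

lemma (in monoid) Units_from_one_sided_inverses:
  assumes "y \<in> carrier G" "a \<in> carrier G" "b \<in> carrier G" "a \<otimes> y = \<one>" "y \<otimes> b = \<one>"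
  shows "y \<in> Units G"
proof -
  have "a = b" using inv_unique assms by blast
  then show ?thesis using assms unfolding Units_def by blast
qed

lemma (in ring_hom_ring) hom_Units:
  assumes "u \<in> Units R" shows "h u \<in> Units S"
proof -
  have "h u \<otimes>\<^bsub>S\<^esub> h (inv u) = \<one>\<^bsub>S\<^esub>" "h (inv u) \<otimes>\<^bsub>S\<^esub> h u = \<one>\<^bsub>S\<^esub>"
    using assms by (simp_all add: R.Units_closed flip: hom_mult)
  then show ?thesis using assms unfolding Units_def[of S]
    by (auto simp: R.Units_closed intro!: bexI[of _ "h (inv u)"])
qed

lemma (in ring_hom_ring) jacobson_image:
  assumes surj: "h ` carrier R = carrier S" and x: "x \<in> jacobson_radical R"
  shows "h x \<in> jacobson_radical S"
proof (rule S.one_minus_multiples_units_imp_jacobson)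
  have xc: "x \<in> carrier R" using x R.jacobson_subset by blast
  then show "h x \<in> carrier S" by simp
  fix a assume "a \<in> carrier S"
  then obtain b where b: "b \<in> carrier R" "a = h b" using surj by blast
  then have "\<one> \<ominus> b \<otimes> x \<in> Units R" by (intro R.one_minus_jacobson_unit R.jacobson_left_mult x)
  then have "h (\<one> \<ominus> b \<otimes> x) \<in> Units S" by (rule hom_Units)
  then show "\<one>\<^bsub>S\<^esub> \<ominus>\<^bsub>S\<^esub> a \<otimes>\<^bsub>S\<^esub> h x \<in> Units S" using b xc by (simp add: R.minus_eq S.minus_eq)
qed

text \<open>An element over 1 is 1 minus a kernel element, hence a unit. If \<open>z\<close> lies
  over the inverse of \<open>h y\<close>, this applies to \<open>y z\<close> and \<open>z y\<close>
  and provides a right and a left inverse of \<open>y\<close>.\<close>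

lemma (in ring_hom_ring) unit_lift:
  assumes surj: "h ` carrier R = carrier S"
    and ker: "\<And>k. k \<in> carrier R \<Longrightarrow> h k = \<zero>\<^bsub>S\<^esub> \<Longrightarrow> \<one> \<ominus> k \<in> Units R"
    and y: "y \<in> carrier R" "h y \<in> Units S"
  shows "y \<in> Units R"
proof -
  have near: "w \<in> Units R" if w: "w \<in> carrier R" "h w = \<one>\<^bsub>S\<^esub>" for w
  proof -
    have "\<one> \<ominus> (\<one> \<ominus> w) \<in> Units R" using w by (intro ker) (auto simp: R.minus_eq S.r_neg)
    moreover have "\<one> \<ominus> (\<one> \<ominus> w) = w"
      using w by (simp add: R.minus_eq R.minus_add R.r_neg2)
    ultimately show ?thesis by simp
  qed
  obtain z where z: "z \<in> carrier R" "h z = inv\<^bsub>S\<^esub> (h y)"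
    using surj y(2) by (metis S.Units_inv_closed imageE)
  have "y \<otimes> z \<in> Units R" "z \<otimes> y \<in> Units R" using z y by (auto intro!: near)
  then have "y \<otimes> (z \<otimes> inv (y \<otimes> z)) = \<one>" "(inv (z \<otimes> y) \<otimes> z) \<otimes> y = \<one>"
    using y z by (simp_all add: R.m_assoc flip: R.m_assoc[of y z] )
  then show ?thesis
    by (intro R.Units_from_one_sided_inverses)
      (use y z \<open>y \<otimes> z \<in> Units R\<close> \<open>z \<otimes> y \<in> Units R\<close> in simp_all)
qed

text \<open>If \<open>h x = t + q\<close>, then \<open>x = s t + (x - s t)\<close>. The section
  \<open>s\<close> keeps \<open>t\<close> a torsion unit, and \<open>x - s t\<close> lies over
  \<open>q\<close>. Both the radical criterion and quasinilpotency ask for units, and these can be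
  tested after applying \<open>h\<close>.\<close>

lemma (in ring_hom_ring) generalized_quasi_t_fine_lift:
  assumes surj: "h ` carrier R = carrier S"
    and ker: "\<And>k. k \<in> carrier R \<Longrightarrow> h k = \<zero>\<^bsub>S\<^esub> \<Longrightarrow> \<one> \<ominus> k \<in> Units R"
    and s: "ring_hom_ring S R s" "\<And>r. r \<in> carrier S \<Longrightarrow> h (s r) = r"
    and S: "generalized_quasi_t_fine S"
  shows "generalized_quasi_t_fine R"
proof -
  interpret s: ring_hom_ring S R s by fact
  have one: "\<one>\<^bsub>S\<^esub> \<noteq> \<zero>\<^bsub>S\<^esub>" using S S.generalized_quasi_t_fine_iff by blast
  then have "\<one> \<noteq> \<zero>" using hom_one hom_zero by metis
  moreover have "\<exists>t\<in>torsion_units R. \<exists>q\<in>quasinilpotents R. x = t \<oplus> q"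
    if x: "x \<in> carrier R" "x \<notin> jacobson_radical R" for x
  proof -
    have "h x \<notin> jacobson_radical S"
    proof
      assume hx: "h x \<in> jacobson_radical S"
      have "x \<in> jacobson_radical R"
      proof (rule R.one_minus_multiples_units_imp_jacobson[OF x(1)])
        fix a assume a: "a \<in> carrier R"
        have "h (\<one> \<ominus> a \<otimes> x) = \<one>\<^bsub>S\<^esub> \<ominus>\<^bsub>S\<^esub> h a \<otimes>\<^bsub>S\<^esub> h x"
          using a x by (simp add: R.minus_eq S.minus_eq)
        also have "\<dots> \<in> Units S"
          using a hx by (intro S.one_minus_jacobson_unit S.jacobson_left_mult) auto
        finally show "\<one> \<ominus> a \<otimes> x \<in> Units R" using unit_lift[OF surj ker] a x by simp
      qed
      with x show False by simp
    qed
    then obtain t q where tq: "t \<in> torsion_units S" "q \<in> quasinilpotents S" "h x = t \<oplus>\<^bsub>S\<^esub> q"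
      using S x by (metis DiffI S.generalized_quasi_t_fine_iff hom_closed)
    have tc: "t \<in> carrier S" and qc: "q \<in> carrier S"
      using tq by (auto simp: torsion_units_def quasinilpotents_def)
    have "s t \<in> torsion_units R"
      using tq(1) tc s.hom_Units s.hom_nat_pow by (force simp: torsion_units_def simp flip: s.hom_nat_pow)
    moreover have "x \<ominus> s t \<in> quasinilpotents R"
      unfolding quasinilpotents_def
    proof (intro CollectI conjI ballI impI)
      show c: "x \<ominus> s t \<in> carrier R" using x tc by simp
      have hq: "h (x \<ominus> s t) = q" using x tc qc tq(3) s(2)
        by (simp add: R.minus_eq S.a_assoc S.a_comm[of t] S.r_neg)
      fix y assume y: "y \<in> carrier R" "y \<otimes> (x \<ominus> s t) = (x \<ominus> s t) \<otimes> y"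
      then have "h y \<otimes>\<^bsub>S\<^esub> q = q \<otimes>\<^bsub>S\<^esub> h y" using hq c by (metis hom_mult)
      then have "\<one>\<^bsub>S\<^esub> \<ominus>\<^bsub>S\<^esub> h y \<otimes>\<^bsub>S\<^esub> q \<in> Units S" using tq(2) y by (simp add: quasinilpotents_def)
      moreover have "h (\<one> \<ominus> y \<otimes> (x \<ominus> s t)) = \<one>\<^bsub>S\<^esub> \<ominus>\<^bsub>S\<^esub> h y \<otimes>\<^bsub>S\<^esub> q"
        unfolding hq[symmetric] using y(1) c by (simp add: R.minus_eq[of \<one>] S.minus_eq)
      ultimately show "\<one> \<ominus> y \<otimes> (x \<ominus> s t) \<in> Units R"
        using unit_lift[OF surj ker] y c by simp
    qed
    moreover have "x = s t \<oplus> (x \<ominus> s t)" using x tc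
      by (simp add: R.minus_eq R.a_lcomm R.r_neg)
    ultimately show ?thesis by blast
  qed
  ultimately show ?thesis using R.generalized_quasi_t_fine_iff by blast
qed

text \<open>An arbitrary preimage of an element commuting with \<open>h q\<close> may fail to
  commute with \<open>q\<close>. Preimages taken through a central section always commute with
  it.\<close>

lemma (in ring_hom_ring) quasinilpotent_image_central_section:
  assumes s: "ring_hom_ring S R s" "\<And>r. r \<in> carrier S \<Longrightarrow> h (s r) = r"
    and central: "\<And>r x. r \<in> carrier S \<Longrightarrow> x \<in> carrier R \<Longrightarrow> s r \<otimes> x = x \<otimes> s r"
    and q: "q \<in> quasinilpotents R"
  shows "h q \<in> quasinilpotents S"
  unfolding quasinilpotents_def
proof (intro CollectI conjI ballI impI)
  interpret s: ring_hom_ring S R s by fact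
  have qc: "q \<in> carrier R" using q by (simp add: quasinilpotents_def)
  then show "h q \<in> carrier S" by simp
  fix y assume y: "y \<in> carrier S"
  have "\<one> \<ominus> s y \<otimes> q \<in> Units R" using q y central qc by (simp add: quasinilpotents_def)
  then have "h (\<one> \<ominus> s y \<otimes> q) \<in> Units S" by (rule hom_Units)
  then show "\<one>\<^bsub>S\<^esub> \<ominus>\<^bsub>S\<^esub> y \<otimes>\<^bsub>S\<^esub> h q \<in> Units S" using y qc s(2) by (simp add: R.minus_eq S.minus_eq)
qed

lemma (in ring_hom_ring) torsion_unit_image:
  "t \<in> torsion_units R \<Longrightarrow> h t \<in> torsion_units S"
  using hom_Units by (force simp: torsion_units_def simp flip: hom_nat_pow)

section \<open>Commutative generalized quasi t-fine rings: locality and residue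
  characteristic\<close>

lemma (in cring) generalized_quasi_t_fine_units:
  assumes "generalized_quasi_t_fine R" "x \<in> carrier R" "x \<notin> jacobson_radical R"
  shows "x \<in> Units R"
proof -
  obtain t q where "t \<in> torsion_units R" "q \<in> quasinilpotents R" "x = t \<oplus> q"
    using assms unfolding generalized_quasi_t_fine_iff by blast
  \<comment> \<open>By commutativity \<open>q\<close> is in the radical, so adding it to
    \<open>t\<close> keeps a unit. Thus all non-units lie in the radical, that is, the ring is
    local.\<close>
  then show ?thesis
    using unit_plus_jacobson[of t q] quasinilpotents_eq_jacobson by (simp add: torsion_units_def)
qed

lemma (in cring) nat_power_add_pow_one: "(add_pow R (a::nat) \<one>) [^] (m::nat) = add_pow R (a ^ m) \<one>"
  by (induction m) (simp_all add: add_pow_ldistr add.nat_pow_pow mult.commute)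

lemma (in cring) torsion_unit_cong_power:
  assumes t: "t \<in> carrier R" and q: "q \<in> jacobson_radical R"
  shows "\<exists>j\<in>jacobson_radical R. (t \<oplus> q) [^] (m::nat) = t [^] m \<oplus> j"
proof (induction m)
  case 0
  show ?case using additive_subgroup.zero_closed[OF jacobson_additive] by (auto intro!: bexI[of _ \<zero>])
next
  case (Suc m)
  interpret J: additive_subgroup "jacobson_radical R" R by (rule jacobson_additive)
  obtain j where j: "j \<in> jacobson_radical R" "(t \<oplus> q) [^] m = t [^] m \<oplus> j" using Suc by blast
  have c: "j \<in> carrier R" "q \<in> carrier R" using j q jacobson_subset by auto
  have "(t \<oplus> q) [^] Suc m = t [^] Suc m \<oplus> (t \<otimes> j \<oplus> (t [^] m \<oplus> j) \<otimes> q)"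
    using t c j by (simp add: l_distr r_distr a_ac m_ac)
  moreover have "t \<otimes> j \<oplus> (t [^] m \<oplus> j) \<otimes> q \<in> jacobson_radical R"
    using t c j q by (intro J.a_closed jacobson_left_mult) auto
  ultimately show ?case by blast
qed

text \<open>Modulo the radical every nonzero element is a root of unity; applied to \<open>2\<close> this shows
  that the residue field has positive characteristic.\<close>

lemma (in cring) generalized_quasi_t_fine_residue_characteristic:
  assumes R: "generalized_quasi_t_fine R"
  shows "\<exists>p::nat. Factorial_Ring.prime p \<and> add_pow R p \<one> \<in> jacobson_radical R"
proof -
  interpret J: additive_subgroup "jacobson_radical R" R by (rule jacobson_additive)
  have one: "\<one> \<noteq> \<zero>" using R generalized_quasi_t_fine_iff by blast
  have J1: "\<one> \<notin> jacobson_radical R"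
  proof
    assume "\<one> \<in> jacobson_radical R"
    then have "\<one> \<ominus> \<one> \<in> Units R" by (rule one_minus_jacobson_unit)
    then have "\<zero> \<in> Units R" by (simp add: minus_eq r_neg)
    then show False using one by (metis Units_l_inv Units_inv_closed r_null)
  qed
  let ?P = "\<lambda>n::nat. n \<ge> 1 \<and> add_pow R n \<one> \<in> jacobson_radical R"
  have "\<exists>n. ?P n"
  proof (cases "add_pow R (2::nat) \<one> \<in> jacobson_radical R")
    case True
    then show ?thesis by (intro exI[of _ 2]) auto
  next
    case False
    then obtain t q where tq: "t \<in> torsion_units R" "q \<in> jacobson_radical R" "add_pow R (2::nat) \<one> = t \<oplus> q"
      using R unfolding generalized_quasi_t_fine_iff quasinilpotents_eq_jacobson
      by (metis DiffI add.nat_pow_closed one_closed)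
    obtain m :: nat where m: "m \<ge> 1" "t [^] m = \<one>" and t: "t \<in> carrier R"
      using tq(1) by (auto simp: torsion_units_def)
    \<comment> \<open>Raising \<open>2 = t + q\<close> to an exponent that kills \<open>t\<close>
      gives \<open>2^m = 1 + j\<close>, so the integer \<open>2^m - 1\<close> lies in the radical;
      it is positive because \<open>m\<close> is.\<close>
    obtain j where j: "j \<in> jacobson_radical R" "add_pow R (2 ^ m :: nat) \<one> = \<one> \<oplus> j"
      using torsion_unit_cong_power[OF t tq(2), of m] m(2) tq(3) nat_power_add_pow_one[of 2 m] by auto
    have jc: "j \<in> carrier R" using j jacobson_subset by blast
    have "2 ^ m = 1 + (2 ^ m - 1 :: nat)" by simp
    then have "add_pow R (2 ^ m :: nat) \<one> = add_pow R (1 + (2 ^ m - 1) :: nat) \<one>" by presburger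
    also have "\<dots> = \<one> \<oplus> add_pow R (2 ^ m - 1 :: nat) \<one>"
      using add.nat_pow_mult[of \<one> 1 "2 ^ m - 1"] by simp
    finally have "add_pow R (2 ^ m - 1 :: nat) \<one> = j" using j jc by simp
    moreover have "(2 ^ m - 1 :: nat) \<ge> 1"
      using m(1) power_increasing[of 1 m "2::nat"] by simp
    ultimately show ?thesis using j(1) by (intro exI[of _ "2 ^ m - 1"]) simp
  qed
  then have L: "?P (Least ?P)" by (rule LeastI_ex)
  define n where "n = Least ?P"
  have n1: "n \<noteq> 1" using L J1 by (auto simp: n_def)
  \<comment> \<open>If \<open>n = a b\<close> with smaller positive factors, minimality puts
    \<open>a\<close> outside the radical, so \<open>a\<close> is a unit and can be cancelled; then
    \<open>b\<close> lies in the radical, against minimality.\<close>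
  have "Factorial_Ring.prime n"
  proof (rule ccontr)
    assume "\<not> Factorial_Ring.prime n"
    moreover have "1 < n" using L n1 unfolding n_def[symmetric] by linarith
    ultimately obtain a where a: "a dvd n" "a \<noteq> 1" "a \<noteq> n" unfolding prime_nat_iff by blast
    then obtain b where b: "n = a * b" by (elim dvdE)
    have ab: "n = a * b" "a < n" "b < n" "1 \<le> a" "1 \<le> b"
      using a b \<open>1 < n\<close> by (cases a; cases b; auto)+
    have na: "\<not> ?P a" "\<not> ?P b" using ab not_less_Least unfolding n_def by blast+
    then have aU: "add_pow R a \<one> \<in> Units R" using ab generalized_quasi_t_fine_units[OF R] by simp
    have "add_pow R a \<one> \<otimes> add_pow R b \<one> = add_pow R n \<one>"
      by (simp add: ab(1) add_pow_ldistr add.nat_pow_pow mult.commute)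
    then have "add_pow R a \<one> \<otimes> add_pow R b \<one> \<in> jacobson_radical R"
      using L unfolding n_def[symmetric] by (metis (no_types))
    then have "inv (add_pow R a \<one>) \<otimes> (add_pow R a \<one> \<otimes> add_pow R b \<one>) \<in> jacobson_radical R"
      by (rule jacobson_left_mult[OF Units_inv_closed[OF aU]])
    moreover have "inv (add_pow R a \<one>) \<otimes> (add_pow R a \<one> \<otimes> add_pow R b \<one>) = add_pow R b \<one>"
      using aU by (simp add: m_assoc[symmetric])
    ultimately have "add_pow R b \<one> \<in> jacobson_radical R" by simp
    then show False using na ab by simp
  qed
  then show ?thesis using L unfolding n_def by blast
qed

text \<open>If both integers were in the radical, Bezout over the naturals, with the 1 on either
  side, would give consecutive integers \<open>n\<close> and \<open>n + 1\<close> in it. But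
  \<open>1 + n\<close> is then a unit, so the radical would contain 1.\<close>

lemma (in ring) coprime_add_pow_one_not_jacobson:
  assumes one: "\<one> \<noteq> \<zero>" and "coprime p (q::nat)" and p: "add_pow R p \<one> \<in> jacobson_radical R"
  shows "add_pow R q \<one> \<notin> jacobson_radical R"
proof
  assume q: "add_pow R q \<one> \<in> jacobson_radical R"
  interpret J: additive_subgroup "jacobson_radical R" R by (rule jacobson_additive)
  have mult: "add_pow R (a * b) \<one> \<in> jacobson_radical R" if "add_pow R b \<one> \<in> jacobson_radical R" for a b :: nat
  proof -
    have "add_pow R a \<one> \<otimes> add_pow R b \<one> = add_pow R (a * b) \<one>"
      by (simp add: add_pow_ldistr add.nat_pow_pow mult.commute)
    then show ?thesis using jacobson_left_mult[OF _ that, of "add_pow R a \<one>"] by simp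
  qed
  have "\<exists>a b. a * p = b * q + 1 \<or> a * q = b * p + 1"
    using bezout_add_nat[of p q] assms(2) by (metis coprime_common_divisor_nat mult.commute)
  then have "\<exists>m n::nat. add_pow R m \<one> \<in> jacobson_radical R \<and> add_pow R n \<one> \<in> jacobson_radical R \<and> m = n + 1"
    using mult p q by metis
  then obtain n :: nat where n: "add_pow R (n + 1) \<one> \<in> jacobson_radical R" "add_pow R n \<one> \<in> jacobson_radical R" by blast
  have "add_pow R (n + 1) \<one> = \<one> \<oplus> add_pow R n \<one>" using add.nat_pow_Suc2[of \<one> n] by simp
  also have "\<dots> \<in> Units R" using n by (rule_tac one_plus_jacobson_unit)
  finally have u: "add_pow R (n + 1) \<one> \<in> Units R" .
  have "inv (add_pow R (n + 1) \<one>) \<otimes> add_pow R (n + 1) \<one> \<in> jacobson_radical R"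
    using u n by (intro jacobson_left_mult) auto
  then have "\<one> \<ominus> \<one> \<in> Units R" using u by (intro one_minus_jacobson_unit) simp
  then have "\<zero> \<in> Units R" by (simp add: minus_eq r_neg)
  then show False using one by (metis Units_l_inv Units_inv_closed r_null)
qed

section \<open>Finite p-groups acting on rings in which p is nilpotent\<close>

text \<open>The binomial theorem in a ring that may be noncommutative, valid because 1 commutes with
  \<open>t\<close>. Binomial coefficients act as integer multiples through
  \<open>add_pow\<close>.\<close>

lemma (in ring) binomial_one_plus:
  assumes t: "t \<in> carrier R"
  shows "(\<one> \<oplus> t) [^] (n::nat) = (\<Oplus>k\<in>{..n}. add_pow R (n choose k) (t [^] k))"
proof (induction n)
  case 0
  then show ?case by simp
next
  case (Suc n)
  let ?c = "\<lambda>k. add_pow R (n choose k) (t [^] k)"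
  have swap: "x \<oplus> y \<oplus> z = x \<oplus> z \<oplus> y"
    if "x \<in> carrier R" "y \<in> carrier R" "z \<in> carrier R" for x y z
    using that by (simp add: a_assoc a_comm[of y])
  have "(\<one> \<oplus> t) [^] Suc n = (\<Oplus>k\<in>{..n}. ?c k) \<oplus> (\<Oplus>k\<in>{..n}. ?c k) \<otimes> t"
    using t Suc by (simp add: r_distr)
  also have "(\<Oplus>k\<in>{..n}. ?c k) \<otimes> t = (\<Oplus>k\<in>{..n}. add_pow R (n choose k) (t [^] Suc k))"
    using t by (subst finsum_ldistr) (auto simp: add_pow_ldistr)
  \<comment> \<open>A vanishing top term is appended, so that splitting off the term at 0 leaves the
    same index range as in the other sum and Pascal's rule applies termwise.\<close>
  also have "(\<Oplus>k\<in>{..n}. ?c k) = (\<Oplus>k\<in>{..Suc n}. ?c k)"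
    using t by (simp add: finsum_Suc binomial_eq_0)
  also have "\<dots> = (\<Oplus>k\<in>{..n}. ?c (Suc k)) \<oplus> ?c 0"
    using t by (subst finsum_Suc2) auto
  also have "\<dots> \<oplus> (\<Oplus>k\<in>{..n}. add_pow R (n choose k) (t [^] Suc k))
      = (\<Oplus>k\<in>{..n}. ?c (Suc k)) \<oplus> (\<Oplus>k\<in>{..n}. add_pow R (n choose k) (t [^] Suc k)) \<oplus> ?c 0"
    using t by (intro swap finsum_closed) auto
  also have "(\<Oplus>k\<in>{..n}. ?c (Suc k)) \<oplus> (\<Oplus>k\<in>{..n}. add_pow R (n choose k) (t [^] Suc k))
      = (\<Oplus>k\<in>{..n}. add_pow R (Suc n choose Suc k) (t [^] Suc k))"
    using t by (subst finsum_addf[symmetric]) (auto simp: add.nat_pow_mult add.commute intro!: finsum_cong')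
  also have "\<dots> \<oplus> ?c 0 = (\<Oplus>k\<in>{..Suc n}. add_pow R (Suc n choose k) (t [^] k))"
    using t by (subst finsum_Suc2) auto
  finally show ?case .
qed

lemma (in additive_subgroup) add_pow_in:
  "abelian_group G \<Longrightarrow> x \<in> H \<Longrightarrow> add_pow G (n::nat) x \<in> H"
proof (induction n)
  case 0
  then show ?case by (simp add: add_pow_def)
next
  case (Suc n)
  then interpret abelian_group G by simp
  show ?case using Suc a_Hcarr[of x] by (simp add: add.nat_pow_Suc)
qed

lemma (in additive_subgroup) finsum_in:
  assumes "abelian_group G" "\<And>i. i \<in> A \<Longrightarrow> f i \<in> H"
  shows "(\<Oplus>\<^bsub>G\<^esub>i\<in>A. f i) \<in> H"
proof -
  interpret abelian_group G by fact
  show ?thesis using assms(2)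
  \<comment> \<open>For infinite \<open>A\<close> the sum has the default value 0, which lies in
    \<open>H\<close>.\<close>
  proof (induction A rule: infinite_finite_induct)
    case (insert x F)
    then have "finsum G f (insert x F) = f x \<oplus>\<^bsub>G\<^esub> finsum G f F"
      by (intro finsum_insert) (auto intro: a_Hcarr)
    then show ?case using insert by simp
  qed auto
qed

text \<open>In characteristic \<open>p\<close> one has \<open>(1 + t)\<^sup>p = 1 + t\<^sup>p\<close>; here this is read modulo \<open>U\<close>.\<close>

lemma (in ring) prime_power_shift_in_additive_subgroup:
  assumes U: "additive_subgroup U R" and p: "Factorial_Ring.prime (p::nat)"
    and t: "t \<in> carrier R" and y: "y \<in> carrier R"
    and pU: "\<And>k. add_pow R p (t [^] (k::nat) \<otimes> y) \<in> U"
    and g: "(\<one> \<oplus> t) [^] p \<otimes> y \<ominus> y \<in> U"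
  shows "t [^] p \<otimes> y \<in> U"
proof -
  interpret U: additive_subgroup U R by fact
  let ?c = "\<lambda>k. add_pow R (p choose k) (t [^] k)"
  \<comment> \<open>The binomial terms strictly between 0 and \<open>p\<close>, whose coefficients
    are divisible by \<open>p\<close>; the index is shifted by one.\<close>
  let ?m = "\<Oplus>k\<in>{..<p - 1}. ?c (Suc k)"
  have p1: "Suc (p - 1) = p" using p prime_gt_0_nat by simp
  have "{..p - 1} = insert (p - 1) {..<p - 1}" by auto
  moreover have "(\<Oplus>k\<in>insert (p - 1) {..<p - 1}. ?c (Suc k)) = ?c p \<oplus> ?m"
    using t p1 by (subst finsum_insert) auto
  ultimately have *: "(\<Oplus>k\<in>{..p - 1}. ?c (Suc k)) = ?m \<oplus> ?c p"
    using t by (simp add: a_comm)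
  have "(\<one> \<oplus> t) [^] p = (\<Oplus>k\<in>{..Suc (p - 1)}. ?c k)"
    using binomial_one_plus[OF t, of p] p1 by simp
  also have "\<dots> = (\<Oplus>k\<in>{..p - 1}. ?c (Suc k)) \<oplus> ?c 0"
    using t by (subst finsum_Suc2) auto
  finally have B: "(\<one> \<oplus> t) [^] p = ?m \<oplus> t [^] p \<oplus> \<one>" using * t by simp
  have "?m \<otimes> y = (\<Oplus>k\<in>{..<p - 1}. ?c (Suc k) \<otimes> y)"
    using t y by (intro finsum_ldistr) auto
  also have "\<dots> \<in> U"
  proof (rule U.finsum_in[OF abelian_group_axioms])
    fix k assume "k \<in> {..<p - 1}"
    then have "p dvd (p choose Suc k)" using p by (intro dvd_choose_prime) auto
    then obtain m where m: "p choose Suc k = p * m" by auto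
    have "?c (Suc k) \<otimes> y = add_pow R m (add_pow R p (t [^] Suc k \<otimes> y))"
      unfolding m using t y by (simp add: add_pow_ldistr add.nat_pow_pow mult.commute)
    then show "?c (Suc k) \<otimes> y \<in> U"
      using U.add_pow_in[OF abelian_group_axioms pU[of "Suc k"], of m] by simp
  qed
  finally have mU: "?m \<otimes> y \<in> U" .
  have m: "?m \<in> carrier R" using t by (intro finsum_closed) auto
  have "(\<one> \<oplus> t) [^] p \<otimes> y \<ominus> y = ?m \<otimes> y \<oplus> t [^] p \<otimes> y"
    unfolding B using m t y by (simp add: l_distr minus_eq a_assoc r_neg)
  then have "(\<ominus> (?m \<otimes> y)) \<oplus> ((\<one> \<oplus> t) [^] p \<otimes> y \<ominus> y) = t [^] p \<otimes> y"
    using m t y by (simp add: r_neg1)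
  then show ?thesis using U.a_closed[OF U.a_inv_closed[OF mU] g] by simp
qed

text \<open>\<open>U\<close> plays the zero of a quotient module on which \<open>H\<close> acts.
  Take a subgroup \<open>N\<close> maximal among those fixing, modulo \<open>U\<close>, some
  \<open>w\<close> outside \<open>U\<close> with \<open>p w\<close> in \<open>U\<close>. If
  \<open>N\<close> is not \<open>H\<close>, some \<open>g\<close> outside \<open>N\<close>
  normalizes \<open>N\<close> and has \<open>g^p\<close> in \<open>N\<close>. With
  \<open>t = g - 1\<close>, the last \<open>t^i w\<close> outside \<open>U\<close> is fixed by
  \<open>N\<close> and by \<open>g\<close>, against maximality.\<close>

lemma (in ring) p_group_fixed_vector:
  fixes H (structure)
  assumes H: "group H" "finite (carrier H)" "p_group p H" and p: "Factorial_Ring.prime p"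
    and d: "d \<in> hom H R" "d \<one>\<^bsub>H\<^esub> = \<one>\<^bsub>R\<^esub>"
    and U: "additive_subgroup U R"
    and stable: "\<And>h y. h \<in> carrier H \<Longrightarrow> y \<in> U \<Longrightarrow> d h \<otimes>\<^bsub>R\<^esub> y \<in> U"
    and v: "v \<in> carrier R" "v \<notin> U" "add_pow R p v \<in> U"
  shows "\<exists>w\<in>carrier R - U. \<forall>h\<in>carrier H. d h \<otimes>\<^bsub>R\<^esub> w \<ominus>\<^bsub>R\<^esub> w \<in> U"
proof -
  interpret H: group H by fact
  interpret U: additive_subgroup U R by fact
  have dc: "d h \<in> carrier R" if "h \<in> carrier H" for h using d(1) that by (auto simp: hom_def)
  have dm: "d (g \<otimes>\<^bsub>H\<^esub> h) = d g \<otimes>\<^bsub>R\<^esub> d h" if "g \<in> carrier H" "h \<in> carrier H" for g h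
    using d(1) that by (auto simp: hom_def)
  have dp: "d (g [^]\<^bsub>H\<^esub> (k::nat)) = d g [^]\<^bsub>R\<^esub> k" if "g \<in> carrier H" for g k
    using that d(2) by (induction k) (simp_all add: dm)
  have split: "d (g \<otimes>\<^bsub>H\<^esub> h) \<otimes>\<^bsub>R\<^esub> w \<ominus>\<^bsub>R\<^esub> w =
      d g \<otimes>\<^bsub>R\<^esub> (d h \<otimes>\<^bsub>R\<^esub> w \<ominus>\<^bsub>R\<^esub> w) \<oplus>\<^bsub>R\<^esub> (d g \<otimes>\<^bsub>R\<^esub> w \<ominus>\<^bsub>R\<^esub> w)"
    if "g \<in> carrier H" "h \<in> carrier H" "w \<in> carrier R" for g h w
    using that dc by (simp add: dm m_assoc r_distr r_minus minus_eq a_assoc r_neg1)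
  let ?Fix = "\<lambda>w. {h \<in> carrier H. d h \<otimes>\<^bsub>R\<^esub> w \<ominus>\<^bsub>R\<^esub> w \<in> U}"
  have Fix: "subgroup (?Fix w) H" if w: "w \<in> carrier R" for w
  proof (rule H.subgroupI)
    show "?Fix w \<noteq> {}" using w d(2) by (auto simp: minus_eq r_neg intro!: exI[of _ "\<one>\<^bsub>H\<^esub>"])
  next
    fix a assume a: "a \<in> ?Fix w"
    then have ac: "a \<in> carrier H" by simp
    have "d (inv\<^bsub>H\<^esub> a) \<otimes>\<^bsub>R\<^esub> (d a \<otimes>\<^bsub>R\<^esub> w \<ominus>\<^bsub>R\<^esub> w) \<in> U" using a by (intro stable) auto
    moreover have "d (inv\<^bsub>H\<^esub> a) \<otimes>\<^bsub>R\<^esub> (d a \<otimes>\<^bsub>R\<^esub> w \<ominus>\<^bsub>R\<^esub> w)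
        = \<ominus>\<^bsub>R\<^esub> (d (inv\<^bsub>H\<^esub> a) \<otimes>\<^bsub>R\<^esub> w \<ominus>\<^bsub>R\<^esub> w)"
      using ac w dc d(2)
      by (simp add: r_distr r_minus minus_eq minus_add a_comm flip: m_assoc dm)
    ultimately show "inv\<^bsub>H\<^esub> a \<in> ?Fix w" using ac w dc U.a_inv_closed by fastforce
  next
    fix a b assume a: "a \<in> ?Fix w" "b \<in> ?Fix w"
    then show "a \<otimes>\<^bsub>H\<^esub> b \<in> ?Fix w" using w by (simp add: split stable)
  qed auto
  let ?P = "\<lambda>N. subgroup N H \<and> (\<exists>w\<in>carrier R - U. add_pow R p w \<in> U \<and> N \<subseteq> ?Fix w)"
  have "finite {N. ?P N}"
    by (rule finite_subset[of _ "Pow (carrier H)"]) (use H(2) in \<open>auto dest: subgroup.subset\<close>)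
  moreover have "{\<one>\<^bsub>H\<^esub>} \<in> {N. ?P N}"
  proof (intro CollectI conjI bexI[of _ v])
    show "{\<one>\<^bsub>H\<^esub>} \<subseteq> ?Fix v" using v(1) d(2) by (simp add: minus_eq r_neg)
  qed (use H.triv_subgroup v in auto)
  ultimately have "\<exists>N\<in>{N. ?P N}. {\<one>\<^bsub>H\<^esub>} \<subseteq> N \<and> (\<forall>M\<in>{N. ?P N}. N \<subseteq> M \<longrightarrow> N = M)"
    by (rule finite_has_maximal2)
  then obtain N where "N \<in> {N. ?P N}" and max': "\<forall>M\<in>{N. ?P N}. N \<subseteq> M \<longrightarrow> N = M"
    by (elim bexE conjE)
  then have N: "?P N" by (rule_tac CollectD)
  have max: "N = M" if "?P M" "N \<subseteq> M" for M
  proof -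
    have "M \<in> {N. ?P N}" using that(1) by (rule CollectI)
    with max' have "N \<subseteq> M \<longrightarrow> N = M" by (rule bspec)
    then show ?thesis using that(2) by (rule mp)
  qed
  then obtain w where w: "w \<in> carrier R" "w \<notin> U" "add_pow R p w \<in> U" "N \<subseteq> ?Fix w"
    using conjunct2[OF N] by (elim bexE conjE DiffE)
  interpret N: subgroup N H by (rule conjunct1[OF N])
  have "N = carrier H"
  proof (rule ccontr)
    assume "N \<noteq> carrier H"
    then obtain g where g: "g \<in> carrier H" "g \<notin> N" "g [^]\<^bsub>H\<^esub> p \<in> N"
      and gN: "\<And>n. n \<in> N \<Longrightarrow> inv\<^bsub>H\<^esub> g \<otimes>\<^bsub>H\<^esub> n \<otimes>\<^bsub>H\<^esub> g \<in> N"
      using H.p_group_normalizer_grows[OF p H(2,3) N.subgroup_axioms] by blast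
    define t where "t = d g \<ominus>\<^bsub>R\<^esub> \<one>\<^bsub>R\<^esub>"
    have t: "t \<in> carrier R" "\<one>\<^bsub>R\<^esub> \<oplus>\<^bsub>R\<^esub> t = d g"
      using dc[OF g(1)] by (simp_all add: t_def minus_eq a_comm[of "\<one>\<^bsub>R\<^esub>"] a_assoc l_neg)
    let ?w = "\<lambda>i::nat. t [^]\<^bsub>R\<^esub> i \<otimes>\<^bsub>R\<^esub> w"
    have wc: "?w i \<in> carrier R" for i using t w by simp
    have wS: "?w (Suc i) = d g \<otimes>\<^bsub>R\<^esub> ?w i \<ominus>\<^bsub>R\<^esub> ?w i" for i
      using t w dc[OF g(1)] nat_pow_Suc2[OF t(1), of i]
      by (simp add: t_def m_assoc l_distr l_minus minus_eq)
    have wN: "N \<subseteq> ?Fix (?w i)" for i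
    proof (induction i)
      case 0
      then show ?case using w by simp
    next
      case (Suc i)
      show ?case
      proof
        fix n assume n: "n \<in> N"
        then have nc: "n \<in> carrier H" using N.mem_carrier by blast
        let ?n = "inv\<^bsub>H\<^esub> g \<otimes>\<^bsub>H\<^esub> n \<otimes>\<^bsub>H\<^esub> g"
        have "?n \<in> N" using gN n by blast
        \<comment> \<open>Since \<open>n g = g n'\<close> with \<open>n'\<close> in
          \<open>N\<close>, applying \<open>g - 1\<close> to a vector fixed by \<open>N\<close>
          gives another such vector.\<close>
        have "n \<otimes>\<^bsub>H\<^esub> g = g \<otimes>\<^bsub>H\<^esub> ?n" using g nc by (simp add: H.m_assoc[symmetric])
        then have "d n \<otimes>\<^bsub>R\<^esub> (d g \<otimes>\<^bsub>R\<^esub> ?w i) = d g \<otimes>\<^bsub>R\<^esub> (d ?n \<otimes>\<^bsub>R\<^esub> ?w i)"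
          using g nc dc wc by (metis H.inv_closed H.m_closed dm m_assoc)
        then have "d n \<otimes>\<^bsub>R\<^esub> ?w (Suc i) \<ominus>\<^bsub>R\<^esub> ?w (Suc i)
          = d g \<otimes>\<^bsub>R\<^esub> (d ?n \<otimes>\<^bsub>R\<^esub> ?w i \<ominus>\<^bsub>R\<^esub> ?w i) \<ominus>\<^bsub>R\<^esub> (d n \<otimes>\<^bsub>R\<^esub> ?w i \<ominus>\<^bsub>R\<^esub> ?w i)"
          unfolding wS using g nc dc wc[of i]
          by (simp add: minus_eq r_distr r_minus minus_add a_ac)
        moreover have "d ?n \<otimes>\<^bsub>R\<^esub> ?w i \<ominus>\<^bsub>R\<^esub> ?w i \<in> U" "d n \<otimes>\<^bsub>R\<^esub> ?w i \<ominus>\<^bsub>R\<^esub> ?w i \<in> U"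
          using Suc \<open>?n \<in> N\<close> n by blast+
        ultimately have "d n \<otimes>\<^bsub>R\<^esub> ?w (Suc i) \<ominus>\<^bsub>R\<^esub> ?w (Suc i) \<in> U"
          using stable[OF g(1)] by (simp add: minus_eq)
        then show "n \<in> ?Fix (?w (Suc i))" using nc by simp
      qed
    qed
    have pw: "add_pow R p (?w i) \<in> U" for i
    proof (induction i)
      case 0
      then show ?case using w by simp
    next
      case (Suc i)
      have "add_pow R p (?w (Suc i)) = d g \<otimes>\<^bsub>R\<^esub> (add_pow R p (?w i)) \<ominus>\<^bsub>R\<^esub> add_pow R p (?w i)"
        unfolding wS using dc[OF g(1)] wc[of i]
        by (simp add: minus_eq add.nat_pow_distrib add_pow_rdistr add.nat_pow_inv)
      then show ?case using stable[OF g(1) Suc] Suc by (simp add: minus_eq)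
    qed
    \<comment> \<open>As \<open>p\<close> kills every \<open>?w i\<close> modulo \<open>U\<close>,
      \<open>t^p w\<close> agrees with \<open>(g^p - 1) w\<close>, which lies in \<open>U\<close>
      because \<open>g^p\<close> is in \<open>N\<close>.\<close>
    have "?w p \<in> U"
    proof (rule prime_power_shift_in_additive_subgroup[OF U p t(1) w(1) pw])
      show "(\<one>\<^bsub>R\<^esub> \<oplus>\<^bsub>R\<^esub> t) [^]\<^bsub>R\<^esub> p \<otimes>\<^bsub>R\<^esub> w \<ominus>\<^bsub>R\<^esub> w \<in> U"
        using w(4) g(3) dp[OF g(1), of p] unfolding t(2) by auto
    qed
    then have L: "?w (LEAST i. ?w i \<in> U) \<in> U" by (rule LeastI)
    have "(LEAST i. ?w i \<in> U) \<noteq> 0"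
    proof
      assume "(LEAST i. ?w i \<in> U) = 0"
      with L have "?w 0 \<in> U" by simp
      then show False using w t by simp
    qed
    then obtain i where i: "(LEAST i. ?w i \<in> U) = Suc i" using not0_implies_Suc by blast
    then have wi: "?w i \<notin> U" using not_less_Least[of i "\<lambda>i. ?w i \<in> U"] by simp
    have gF: "g \<in> ?Fix (?w i)" using L g(1) unfolding i wS by simp
    have "?P (?Fix (?w i))"
      by (intro conjI bexI[of _ "?w i"] Fix wc pw subset_refl DiffI wi)
    then have "N = ?Fix (?w i)" using wN by (rule max)
    from this[symmetric] gF have "g \<in> N" by (rule subst)
    with g(2) show False by (rule notE)
  qed
  then show ?thesis using w by blast
qed

text \<open>For \<open>D\<close> inside the ring, level \<open>n\<close> is the right annihilator of
  all products of \<open>n\<close> elements of \<open>D\<close>. For \<open>D\<close> consisting of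
  the \<open>h - 1\<close>, it measures how nilpotently the augmentation ideal acts.\<close>

primrec annihilator_chain :: "('a, 'm) ring_scheme \<Rightarrow> 'a set \<Rightarrow> nat \<Rightarrow> 'a set" where
  "annihilator_chain R D 0 = {\<zero>\<^bsub>R\<^esub>}"
| "annihilator_chain R D (Suc n) =
    {y \<in> carrier R. \<forall>t\<in>D. t \<otimes>\<^bsub>R\<^esub> y \<in> annihilator_chain R D n}"

lemma (in ring) annihilator_chain_subgroup:
  assumes "D \<subseteq> carrier R"
  shows "additive_subgroup (annihilator_chain R D n) R"
proof (induction n)
  case 0
  show ?case by (simp add: additive_subgroup_def add.triv_subgroup[simplified])
next
  case (Suc n)
  interpret U: additive_subgroup "annihilator_chain R D n" R by fact
  have tc: "t \<in> carrier R" if "t \<in> D" for t using that assms by blast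
  show ?case
    unfolding additive_subgroup_def
  proof (rule add.subgroupI)
    show "annihilator_chain R D (Suc n) \<noteq> {}"
      using tc by (auto intro!: exI[of _ \<zero>])
  qed (use tc in \<open>auto simp: r_distr r_minus\<close>)
qed

lemma (in ring) annihilator_chain_mono:
  assumes "D \<subseteq> carrier R"
  shows "annihilator_chain R D n \<subseteq> annihilator_chain R D (Suc n)"
proof (induction n)
  case 0
  show ?case using assms by auto
next
  case (Suc n)
  then show ?case by auto
qed

text \<open>The union of the chain is everything: a vector outside it could be chosen fixed modulo the
  union, and then, the group being finite, it would lie in the chain after all.\<close>

lemma (in ring) p_group_annihilator_chain_exhausts:
  fixes H (structure)
  assumes H: "group H" "finite (carrier H)" "p_group p H" and p: "Factorial_Ring.prime p"
    and d: "d \<in> hom H R" "d \<one>\<^bsub>H\<^esub> = \<one>\<^bsub>R\<^esub>"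
    and nil: "add_pow R p \<one>\<^bsub>R\<^esub> \<in> nilpotents R" and y: "y \<in> carrier R"
  shows "\<exists>n. y \<in> annihilator_chain R ((\<lambda>h. d h \<ominus>\<^bsub>R\<^esub> \<one>\<^bsub>R\<^esub>) ` carrier H) n"
proof (rule ccontr)
  assume no: "\<not> ?thesis"
  interpret H: group H by fact
  let ?D = "(\<lambda>h. d h \<ominus>\<^bsub>R\<^esub> \<one>\<^bsub>R\<^esub>) ` carrier H"
  let ?L = "annihilator_chain R ?D"
  let ?U = "\<Union>n. ?L n"
  have dc: "d h \<in> carrier R" if "h \<in> carrier H" for h using d(1) that by (auto simp: hom_def)
  have dm: "d (g \<otimes>\<^bsub>H\<^esub> h) = d g \<otimes>\<^bsub>R\<^esub> d h" if "g \<in> carrier H" "h \<in> carrier H" for g h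
    using d(1) that by (auto simp: hom_def)
  have D: "?D \<subseteq> carrier R" using dc by auto
  have L: "additive_subgroup (?L n) R" for n by (rule annihilator_chain_subgroup[OF D])
  have mono: "?L m \<subseteq> ?L n" if "m \<le> n" for m n
    using that annihilator_chain_mono[OF D] by (rule lift_Suc_mono_le[rotated])
  have U: "additive_subgroup ?U R"
    unfolding additive_subgroup_def
  proof (rule add.subgroupI)
    show "?U \<subseteq> carrier R" using additive_subgroup.a_subset[OF L] by blast
    show "?U \<noteq> {}" using additive_subgroup.zero_closed[OF L] by blast
  next
    fix a assume "a \<in> ?U"
    then show "\<ominus>\<^bsub>R\<^esub> a \<in> ?U" using additive_subgroup.a_inv_closed[OF L] by blast
  next
    fix a b assume "a \<in> ?U" "b \<in> ?U"
    then obtain m n where "a \<in> ?L m" "b \<in> ?L n" by blast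
    then have "a \<in> ?L (max m n)" "b \<in> ?L (max m n)"
      using mono[of m "max m n"] mono[of n "max m n"] by auto
    then show "a \<oplus>\<^bsub>R\<^esub> b \<in> ?U" using additive_subgroup.a_closed[OF L] by blast
  qed
  have stable: "d h \<otimes>\<^bsub>R\<^esub> x \<in> ?L n" if h: "h \<in> carrier H" and "x \<in> ?L n" for h x n
    using that(2)
  proof (induction n arbitrary: x)
    case 0
    then show ?case using dc[OF h] by simp
  next
    case (Suc n)
    then have x: "x \<in> carrier R" by simp
    have "(d k \<ominus>\<^bsub>R\<^esub> \<one>\<^bsub>R\<^esub>) \<otimes>\<^bsub>R\<^esub> (d h \<otimes>\<^bsub>R\<^esub> x) \<in> ?L n" if k: "k \<in> carrier H" for k
    proof -
      \<comment> \<open>Each level is stable under the group because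
        \<open>(k - 1) h = h (k' - 1)\<close> for the conjugate \<open>k'\<close> of
        \<open>k\<close> by \<open>h\<close>.\<close>
      let ?k = "inv\<^bsub>H\<^esub> h \<otimes>\<^bsub>H\<^esub> k \<otimes>\<^bsub>H\<^esub> h"
      have "d k \<otimes>\<^bsub>R\<^esub> d h = d h \<otimes>\<^bsub>R\<^esub> d ?k"
        using h k by (simp flip: dm add: H.m_assoc[symmetric])
      then have "(d k \<ominus>\<^bsub>R\<^esub> \<one>\<^bsub>R\<^esub>) \<otimes>\<^bsub>R\<^esub> (d h \<otimes>\<^bsub>R\<^esub> x) = d h \<otimes>\<^bsub>R\<^esub> ((d ?k \<ominus>\<^bsub>R\<^esub> \<one>\<^bsub>R\<^esub>) \<otimes>\<^bsub>R\<^esub> x)"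
        using h k x dc by (simp add: minus_eq l_distr r_distr l_minus r_minus m_assoc[symmetric])
      moreover have "(d ?k \<ominus>\<^bsub>R\<^esub> \<one>\<^bsub>R\<^esub>) \<otimes>\<^bsub>R\<^esub> x \<in> ?L n"
        using Suc.prems h k by auto
      ultimately show ?thesis using Suc.IH by simp
    qed
    then show ?case using x dc[OF h] by auto
  qed
  have yU: "y \<notin> ?U" using no by blast
  \<comment> \<open>Nilpotency of \<open>p\<close> brings the multiples \<open>p^i y\<close> into
    \<open>?U\<close> eventually. The last one outside is a vector killed by \<open>p\<close> modulo
    \<open>?U\<close>, as the fixed vector argument requires.\<close>
  let ?z = "\<lambda>i. (add_pow R p \<one>\<^bsub>R\<^esub>) [^]\<^bsub>R\<^esub> (i::nat) \<otimes>\<^bsub>R\<^esub> y"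
  have zS: "?z (Suc i) = add_pow R p (?z i)" for i
  proof -
    have "?z (Suc i) = add_pow R p \<one>\<^bsub>R\<^esub> \<otimes>\<^bsub>R\<^esub> ?z i"
      using y nat_pow_Suc2[of "add_pow R p \<one>\<^bsub>R\<^esub>" i] by (simp add: m_assoc)
    then show ?thesis using y by (simp add: add_pow_ldistr)
  qed
  obtain n :: nat where "add_pow R p \<one>\<^bsub>R\<^esub> [^]\<^bsub>R\<^esub> n = \<zero>\<^bsub>R\<^esub>" using nil by (auto simp: nilpotents_def)
  then have "?z n \<in> ?U" using y additive_subgroup.zero_closed[OF U] by simp
  then have Z: "?z (LEAST i. ?z i \<in> ?U) \<in> ?U" by (rule LeastI)
  have "(LEAST i. ?z i \<in> ?U) \<noteq> 0"
  proof
    assume "(LEAST i. ?z i \<in> ?U) = 0"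
    with Z have "?z 0 \<in> ?U" by simp
    then show False using y yU by simp
  qed
  then obtain i where i: "(LEAST i. ?z i \<in> ?U) = Suc i" using not0_implies_Suc by blast
  then have zi: "?z i \<notin> ?U" using not_less_Least[of i "\<lambda>i. ?z i \<in> ?U"] by simp
  have pz: "add_pow R p (?z i) \<in> ?U" using Z unfolding i zS .
  have stableU: "d h \<otimes>\<^bsub>R\<^esub> x \<in> ?U" if "h \<in> carrier H" "x \<in> ?U" for h x using stable that by blast
  obtain w where w: "w \<in> carrier R - ?U" "\<forall>h\<in>carrier H. d h \<otimes>\<^bsub>R\<^esub> w \<ominus>\<^bsub>R\<^esub> w \<in> ?U"
    using p_group_fixed_vector[OF H p d U stableU _ zi pz] y by auto
  then have "\<forall>h\<in>carrier H. \<exists>n. (d h \<ominus>\<^bsub>R\<^esub> \<one>\<^bsub>R\<^esub>) \<otimes>\<^bsub>R\<^esub> w \<in> ?L n"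
    using dc by (simp add: minus_eq l_distr l_minus)
  then obtain N where N: "\<And>h. h \<in> carrier H \<Longrightarrow> (d h \<ominus>\<^bsub>R\<^esub> \<one>\<^bsub>R\<^esub>) \<otimes>\<^bsub>R\<^esub> w \<in> ?L (N h)" by metis
  \<comment> \<open>Finiteness of the group yields one level containing all
    \<open>(h - 1) w\<close>, so \<open>w\<close> itself lies one level higher.\<close>
  have "(d h \<ominus>\<^bsub>R\<^esub> \<one>\<^bsub>R\<^esub>) \<otimes>\<^bsub>R\<^esub> w \<in> ?L (Max (N ` carrier H))" if "h \<in> carrier H" for h
    using N[OF that] mono[of "N h" "Max (N ` carrier H)"] H(2) that by auto
  then have "w \<in> ?L (Suc (Max (N ` carrier H)))" using w by auto
  then show False using w by blast
qed

text \<open>Each multiplication by \<open>x\<close> descends one level. Starting from 1 at level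
  \<open>n\<close>, the power \<open>x^n\<close> arrives at level 0, which is zero.\<close>

lemma (in ring) annihilator_chain_imp_nilpotent:
  assumes x: "x \<in> carrier R"
    and dec: "\<And>n y. y \<in> annihilator_chain R D (Suc n) \<Longrightarrow> x \<otimes> y \<in> annihilator_chain R D n"
    and one: "\<one> \<in> annihilator_chain R D n"
  shows "x [^] n = \<zero>"
proof -
  have "x [^] i \<in> annihilator_chain R D (n - i)" if "i \<le> n" for i
    using that
  proof (induction i)
    case 0
    then show ?case using one by simp
  next
    case (Suc i)
    then have "x [^] i \<in> annihilator_chain R D (Suc (n - Suc i))" by (simp add: Suc_diff_Suc)
    then have "x \<otimes> x [^] i \<in> annihilator_chain R D (n - Suc i)" by (rule dec)
    then show ?case using x nat_pow_Suc2 by simp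
  qed
  from this[of n] show ?thesis by simp
qed

text \<open>Used twice: to invert 1 minus a nilpotent element, for which both sides are needed, and
  to find zero divisors from group elements of finite order.\<close>

lemma (in ring) geometric_sum:
  assumes x: "x \<in> carrier R"
  shows "(\<one> \<ominus> x) \<otimes> (\<Oplus>i\<in>{..<n::nat}. x [^] i) = \<one> \<ominus> x [^] n"
    and "(\<Oplus>i\<in>{..<n::nat}. x [^] i) \<otimes> (\<one> \<ominus> x) = \<one> \<ominus> x [^] n"
proof (induction n)
  case 0
  case 1 show ?case using x by (simp add: minus_eq r_neg)
  case 2 show ?case using x by (simp add: minus_eq r_neg)
next
  case (Suc n)
  let ?s = "\<Oplus>i\<in>{..<n}. x [^] i"
  have s: "?s \<in> carrier R" using x by simp
  have S: "(\<Oplus>i\<in>{..<Suc n}. x [^] i) = ?s \<oplus> x [^] n"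
    using x by (simp add: lessThan_Suc a_comm)
  have xn: "x \<otimes> x [^] n = x [^] Suc n" using x nat_pow_Suc2 by simp
  case 1
  have "(\<one> \<ominus> x) \<otimes> (?s \<oplus> x [^] n) = (\<one> \<ominus> x [^] n) \<oplus> (x [^] n \<ominus> x [^] Suc n)"
    using x s Suc(1) xn by (simp add: r_distr l_distr[of _ _ "x [^] n"] minus_eq l_minus)
  then show ?case unfolding S using x by (simp add: minus_eq a_assoc r_neg1)
  case 2
  have "(?s \<oplus> x [^] n) \<otimes> (\<one> \<ominus> x) = (\<one> \<ominus> x [^] n) \<oplus> (x [^] n \<ominus> x [^] Suc n)"
    using x s Suc(2) by (simp add: l_distr r_distr[of _ _ "x [^] n"] minus_eq r_minus)
  then show ?case unfolding S using x by (simp add: minus_eq a_assoc r_neg1)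
qed

lemma (in ring) one_minus_nilpotent_unit:
  assumes x: "x \<in> carrier R" "x [^] (n::nat) = \<zero>"
  shows "\<one> \<ominus> x \<in> Units R"
proof -
  have "(\<Oplus>i\<in>{..<n}. x [^] i) \<in> carrier R" "\<one> \<ominus> x \<in> carrier R" using x by simp_all
  then show ?thesis
    using geometric_sum[OF x(1), of n] x by (auto simp: Units_def minus_eq)
qed

section \<open>Group rings\<close>

locale group_ring_over = R: ring R + G: group G
  for R :: "('r, 'm) ring_scheme" and G :: "('g, 'n) monoid_scheme" +
  fixes A :: "('g \<Rightarrow> 'r) ring"
  assumes A_def: "A = group_ring R G"

sublocale group_ring_over \<subseteq> A: ring A
  unfolding A_def by (rule group_ring_ring) unfold_locales

section \<open>Coefficients, monomials and the augmentation map\<close>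

context group_ring_over begin

definition supp :: "('g \<Rightarrow> 'r) \<Rightarrow> 'g set"
  where "supp a = {g \<in> carrier G. a g \<noteq> \<zero>\<^bsub>R\<^esub>}"

definition single :: "'r \<Rightarrow> 'g \<Rightarrow> 'g \<Rightarrow> 'r"
  where "single r g = (\<lambda>x\<in>carrier G. if x = g then r else \<zero>\<^bsub>R\<^esub>)"

text \<open>The sum runs over the support because over an infinite group it would default to
  0.\<close>

definition aug :: "('g \<Rightarrow> 'r) \<Rightarrow> 'r"
  where "aug a = (\<Oplus>\<^bsub>R\<^esub>g\<in>supp a. a g)"

lemma carrier_iff: "a \<in> carrier A \<longleftrightarrow> a \<in> carrier G \<rightarrow>\<^sub>E carrier R \<and> finite (supp a)"
  by (simp add: A_def group_ring_def supp_def)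

lemma coeff_closed [simp, intro]: "a \<in> carrier A \<Longrightarrow> g \<in> carrier G \<Longrightarrow> a g \<in> carrier R"
  by (auto simp: carrier_iff)

lemma supp_subset: "supp a \<subseteq> carrier G"
  by (auto simp: supp_def)

lemma finite_supp: "a \<in> carrier A \<Longrightarrow> finite (supp a)"
  by (simp add: carrier_iff)

lemma not_in_supp: "g \<in> carrier G \<Longrightarrow> g \<notin> supp a \<Longrightarrow> a g = \<zero>\<^bsub>R\<^esub>"
  by (simp add: supp_def)

lemma elem_eqI:
  assumes "a \<in> carrier A" "b \<in> carrier A" "\<And>g. g \<in> carrier G \<Longrightarrow> a g = b g"
  shows "a = b"
proof (rule PiE_ext)
  show "a \<in> carrier G \<rightarrow>\<^sub>E carrier R" "b \<in> carrier G \<rightarrow>\<^sub>E carrier R"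
    using assms by (simp_all add: carrier_iff)
qed (fact assms(3))

lemma add_apply: "g \<in> carrier G \<Longrightarrow> (a \<oplus>\<^bsub>A\<^esub> b) g = a g \<oplus>\<^bsub>R\<^esub> b g"
  by (simp add: A_def group_ring_def)

lemma zero_apply: "g \<in> carrier G \<Longrightarrow> \<zero>\<^bsub>A\<^esub> g = \<zero>\<^bsub>R\<^esub>"
  by (simp add: A_def group_ring_def)

lemma one_eq_single: "\<one>\<^bsub>A\<^esub> = single \<one>\<^bsub>R\<^esub> \<one>\<^bsub>G\<^esub>"
  by (simp add: A_def group_ring_def single_def)

lemma uminus_apply:
  assumes "a \<in> carrier A" "g \<in> carrier G"
  shows "(\<ominus>\<^bsub>A\<^esub> a) g = \<ominus>\<^bsub>R\<^esub> (a g)"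
proof -
  have "(\<ominus>\<^bsub>A\<^esub> a) g \<oplus>\<^bsub>R\<^esub> a g = \<zero>\<^bsub>R\<^esub>"
    using assms add_apply[of g "\<ominus>\<^bsub>A\<^esub> a" a] by (simp add: A.l_neg zero_apply)
  then show ?thesis using assms by (intro R.minus_equality[symmetric]) auto
qed

lemma minus_apply:
  "a \<in> carrier A \<Longrightarrow> b \<in> carrier A \<Longrightarrow> g \<in> carrier G \<Longrightarrow> (a \<ominus>\<^bsub>A\<^esub> b) g = a g \<ominus>\<^bsub>R\<^esub> b g"
  by (simp add: A.minus_eq R.minus_eq add_apply uminus_apply)

text \<open>Terms outside the support vanish. The freedom in \<open>F\<close> allows several
  convolutions to be summed over a common index set.\<close>

lemma mult_apply:
  assumes a: "a \<in> carrier A" and b: "b \<in> carrier A" and g: "g \<in> carrier G"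
    and F: "finite F" "supp a \<subseteq> F" "F \<subseteq> carrier G"
  shows "(a \<otimes>\<^bsub>A\<^esub> b) g = (\<Oplus>\<^bsub>R\<^esub>h\<in>F. a h \<otimes>\<^bsub>R\<^esub> b (inv\<^bsub>G\<^esub> h \<otimes>\<^bsub>G\<^esub> g))"
proof -
  have c: "h \<in> carrier G" if "h \<in> F" for h using that F(3) by blast
  have z: "a h = \<zero>\<^bsub>R\<^esub>" if "h \<in> F - supp a" for h using that c not_in_supp by blast
  have "(a \<otimes>\<^bsub>A\<^esub> b) g = (\<Oplus>\<^bsub>R\<^esub>h\<in>supp a. a h \<otimes>\<^bsub>R\<^esub> b (inv\<^bsub>G\<^esub> h \<otimes>\<^bsub>G\<^esub> g))"
    using g by (simp add: A_def group_ring_def supp_def)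
  also have "\<dots> = (\<Oplus>\<^bsub>R\<^esub>h\<in>F. a h \<otimes>\<^bsub>R\<^esub> b (inv\<^bsub>G\<^esub> h \<otimes>\<^bsub>G\<^esub> g))"
    by (rule R.add.finprod_mono_neutral_cong_left)
      (use F a b g c z in auto)
  finally show ?thesis .
qed

lemma single_apply: "x \<in> carrier G \<Longrightarrow> single r g x = (if x = g then r else \<zero>\<^bsub>R\<^esub>)"
  by (simp add: single_def)

lemma supp_single: "supp (single r g) \<subseteq> {g}"
  by (auto simp: supp_def single_apply split: if_splits)

lemma single_closed [simp, intro]: "r \<in> carrier R \<Longrightarrow> single r g \<in> carrier A"
  unfolding carrier_iff using finite_subset[OF supp_single] by (auto simp: single_def)

lemma single_mult_apply:
  assumes "r \<in> carrier R" "h \<in> carrier G" "a \<in> carrier A" "g \<in> carrier G"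
  shows "(single r h \<otimes>\<^bsub>A\<^esub> a) g = r \<otimes>\<^bsub>R\<^esub> a (inv\<^bsub>G\<^esub> h \<otimes>\<^bsub>G\<^esub> g)"
  using assms supp_single[of r h] mult_apply[of "single r h" a g "{h}"]
  by (simp add: single_apply)

lemma single_mult_single:
  assumes "r \<in> carrier R" "s \<in> carrier R" "g \<in> carrier G" "h \<in> carrier G"
  shows "single r g \<otimes>\<^bsub>A\<^esub> single s h = single (r \<otimes>\<^bsub>R\<^esub> s) (g \<otimes>\<^bsub>G\<^esub> h)"
proof (rule elem_eqI)
  fix x assume x: "x \<in> carrier G"
  have "inv\<^bsub>G\<^esub> g \<otimes>\<^bsub>G\<^esub> x = h \<longleftrightarrow> x = g \<otimes>\<^bsub>G\<^esub> h"
    using assms x by (metis G.inv_solve_left)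
  then show "(single r g \<otimes>\<^bsub>A\<^esub> single s h) x = single (r \<otimes>\<^bsub>R\<^esub> s) (g \<otimes>\<^bsub>G\<^esub> h) x"
    using assms x by (simp add: single_mult_apply single_apply)
qed (use assms in auto)

lemma finsum_apply:
  assumes "finite F" "\<And>i. i \<in> F \<Longrightarrow> f i \<in> carrier A" and g: "g \<in> carrier G"
  shows "(\<Oplus>\<^bsub>A\<^esub>i\<in>F. f i) g = (\<Oplus>\<^bsub>R\<^esub>i\<in>F. f i g)"
  using assms(1,2)
proof (induction F rule: finite_induct)
  case empty
  then show ?case using g by (simp add: zero_apply)
next
  case (insert i F)
  then have "(\<Oplus>\<^bsub>A\<^esub>i\<in>insert i F. f i) g = (f i \<oplus>\<^bsub>A\<^esub> (\<Oplus>\<^bsub>A\<^esub>i\<in>F. f i)) g"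
    by (subst A.finsum_insert) auto
  also have "\<dots> = f i g \<oplus>\<^bsub>R\<^esub> (\<Oplus>\<^bsub>R\<^esub>i\<in>F. f i g)"
    using insert g by (simp add: add_apply)
  also have "\<dots> = (\<Oplus>\<^bsub>R\<^esub>i\<in>insert i F. f i g)"
    using insert g by (subst R.finsum_insert) auto
  finally show ?case .
qed

lemma eq_sum_of_singles:
  assumes a: "a \<in> carrier A" and F: "finite F" "supp a \<subseteq> F" "F \<subseteq> carrier G"
  shows "a = (\<Oplus>\<^bsub>A\<^esub>h\<in>F. single (a h) h)"
proof (rule elem_eqI)
  have c: "h \<in> carrier G" if "h \<in> F" for h using that F(3) by blast
  fix g assume g: "g \<in> carrier G"
  have "(\<Oplus>\<^bsub>A\<^esub>h\<in>F. single (a h) h) g = (\<Oplus>\<^bsub>R\<^esub>h\<in>F. single (a h) h g)"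
    using F a c g by (intro finsum_apply) auto
  also have "\<dots> = (\<Oplus>\<^bsub>R\<^esub>h\<in>F. if g = h then a h else \<zero>\<^bsub>R\<^esub>)"
    using a c g by (intro R.finsum_cong') (auto simp: single_apply)
  also have "\<dots> = a g"
  proof (cases "g \<in> F")
    case True
    then show ?thesis using F a c by (intro R.finsum_singleton) auto
  next
    case False
    then have "a g = \<zero>\<^bsub>R\<^esub>" using F(2) g not_in_supp by blast
    moreover have "(\<Oplus>\<^bsub>R\<^esub>h\<in>F. if g = h then a h else \<zero>\<^bsub>R\<^esub>) = \<zero>\<^bsub>R\<^esub>"
      using False by (intro R.add.finprod_one_eqI) auto
    ultimately show ?thesis by simp
  qed
  finally show "a g = (\<Oplus>\<^bsub>A\<^esub>h\<in>F. single (a h) h) g" by simp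
qed (use a F in \<open>auto intro!: A.finsum_closed\<close>)

lemma aug_eq:
  assumes a: "a \<in> carrier A" and F: "finite F" "supp a \<subseteq> F" "F \<subseteq> carrier G"
  shows "aug a = (\<Oplus>\<^bsub>R\<^esub>g\<in>F. a g)"
proof -
  have c: "h \<in> carrier G" if "h \<in> F" for h using that F(3) by blast
  have z: "a h = \<zero>\<^bsub>R\<^esub>" if "h \<in> F - supp a" for h using that c not_in_supp by blast
  show ?thesis unfolding aug_def
    by (rule R.add.finprod_mono_neutral_cong_left) (use F a c z in auto)
qed

lemma aug_closed [simp, intro]: "a \<in> carrier A \<Longrightarrow> aug a \<in> carrier R"
  unfolding aug_def using supp_subset by (intro R.finsum_closed) auto

lemma aug_single [simp]:
  assumes "r \<in> carrier R" "g \<in> carrier G" shows "aug (single r g) = r"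
  using assms supp_single aug_eq[of "single r g" "{g}"] by (simp add: single_apply)

text \<open>The double sum is exchanged and the inner one reindexed by \<open>g\<close> to
  \<open>inv h \<otimes> g\<close>. The set \<open>K\<close> of products of support elements
  contains the support of the product, and its translate by \<open>inv h\<close> contains that of
  \<open>b\<close>.\<close>

lemma aug_mult:
  assumes a: "a \<in> carrier A" and b: "b \<in> carrier A"
  shows "aug (a \<otimes>\<^bsub>A\<^esub> b) = aug a \<otimes>\<^bsub>R\<^esub> aug b"
proof -
  define K where "K = (\<lambda>(h, k). h \<otimes>\<^bsub>G\<^esub> k) ` (supp a \<times> supp b)"
  have K: "finite K" "K \<subseteq> carrier G"
    using finite_supp[OF a] finite_supp[OF b] supp_subset by (auto simp: K_def)
  have c: "k \<in> carrier G" if "k \<in> K" for k using that K by blast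
  have ca: "h \<in> carrier G" if "h \<in> supp a" for h using that supp_subset by blast
  have "(a \<otimes>\<^bsub>A\<^esub> b) g = \<zero>\<^bsub>R\<^esub>" if g: "g \<in> carrier G" "g \<notin> K" for g
  proof -
    have "b (inv\<^bsub>G\<^esub> h \<otimes>\<^bsub>G\<^esub> g) = \<zero>\<^bsub>R\<^esub>" if h: "h \<in> supp a" for h
    proof (rule ccontr)
      assume "b (inv\<^bsub>G\<^esub> h \<otimes>\<^bsub>G\<^esub> g) \<noteq> \<zero>\<^bsub>R\<^esub>"
      then have "inv\<^bsub>G\<^esub> h \<otimes>\<^bsub>G\<^esub> g \<in> supp b" using ca[OF h] g by (simp add: supp_def)
      then have "h \<otimes>\<^bsub>G\<^esub> (inv\<^bsub>G\<^esub> h \<otimes>\<^bsub>G\<^esub> g) \<in> K" using h unfolding K_def by force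
      then show False using ca[OF h] g by (simp add: G.m_assoc[symmetric])
    qed
    then have "(\<Oplus>\<^bsub>R\<^esub>h\<in>supp a. a h \<otimes>\<^bsub>R\<^esub> b (inv\<^bsub>G\<^esub> h \<otimes>\<^bsub>G\<^esub> g)) = \<zero>\<^bsub>R\<^esub>"
      using a ca by (intro R.add.finprod_one_eqI) (auto simp: coeff_closed)
    then show ?thesis using mult_apply[OF a b g(1) finite_supp[OF a] subset_refl supp_subset] by simp
  qed
  then have sK: "supp (a \<otimes>\<^bsub>A\<^esub> b) \<subseteq> K" by (auto simp: supp_def)
  have "aug (a \<otimes>\<^bsub>A\<^esub> b) = (\<Oplus>\<^bsub>R\<^esub>g\<in>K. (a \<otimes>\<^bsub>A\<^esub> b) g)"
    using aug_eq[OF _ K(1) sK K(2)] a b by simp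
  also have "\<dots> = (\<Oplus>\<^bsub>R\<^esub>g\<in>K. \<Oplus>\<^bsub>R\<^esub>h\<in>supp a. a h \<otimes>\<^bsub>R\<^esub> b (inv\<^bsub>G\<^esub> h \<otimes>\<^bsub>G\<^esub> g))"
    using a b c ca mult_apply[OF a b _ finite_supp[OF a] subset_refl supp_subset]
    by (intro R.finsum_cong') (auto intro!: R.finsum_closed)
  also have "\<dots> = (\<Oplus>\<^bsub>R\<^esub>h\<in>supp a. \<Oplus>\<^bsub>R\<^esub>g\<in>K. a h \<otimes>\<^bsub>R\<^esub> b (inv\<^bsub>G\<^esub> h \<otimes>\<^bsub>G\<^esub> g))"
    using a b c ca K finite_supp[OF a] by (intro R.finsum_swap_finite) auto
  also have "\<dots> = (\<Oplus>\<^bsub>R\<^esub>h\<in>supp a. a h \<otimes>\<^bsub>R\<^esub> aug b)"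
  proof (rule R.finsum_cong')
    fix h assume h: "h \<in> supp a"
    have inj: "inj_on (\<lambda>g. inv\<^bsub>G\<^esub> h \<otimes>\<^bsub>G\<^esub> g) K"
      using c ca[OF h] by (intro inj_onI) (metis G.inv_closed G.l_cancel)
    let ?L = "(\<lambda>g. inv\<^bsub>G\<^esub> h \<otimes>\<^bsub>G\<^esub> g) ` K"
    have "supp b \<subseteq> ?L"
    proof
      fix l assume l: "l \<in> supp b"
      then have "h \<otimes>\<^bsub>G\<^esub> l \<in> K" using h by (force simp: K_def)
      moreover have "l = inv\<^bsub>G\<^esub> h \<otimes>\<^bsub>G\<^esub> (h \<otimes>\<^bsub>G\<^esub> l)"
        using ca[OF h] l by (simp add: supp_def G.m_assoc[symmetric])
      ultimately show "l \<in> ?L" by blast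
    qed
    then have "aug b = (\<Oplus>\<^bsub>R\<^esub>l\<in>?L. b l)" using K c ca[OF h] by (intro aug_eq b) auto
    also have "\<dots> = (\<Oplus>\<^bsub>R\<^esub>g\<in>K. b (inv\<^bsub>G\<^esub> h \<otimes>\<^bsub>G\<^esub> g))"
      using b c ca[OF h] inj by (intro R.finsum_reindex) auto
    finally show "(\<Oplus>\<^bsub>R\<^esub>g\<in>K. a h \<otimes>\<^bsub>R\<^esub> b (inv\<^bsub>G\<^esub> h \<otimes>\<^bsub>G\<^esub> g)) = a h \<otimes>\<^bsub>R\<^esub> aug b"
      using a b c ca[OF h] K by (simp add: R.finsum_rdistr Pi_def)
  qed (use a b ca in auto)
  also have "\<dots> = aug a \<otimes>\<^bsub>R\<^esub> aug b"
    unfolding aug_def[of a] using a b ca finite_supp[OF a] by (intro R.finsum_ldistr[symmetric]) auto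
  finally show ?thesis .
qed

lemma aug_hom: "ring_hom_ring A R aug"
proof (rule ring_hom_ringI)
  fix a b assume a: "a \<in> carrier A" and b: "b \<in> carrier A"
  let ?F = "supp a \<union> supp b"
  have F: "finite ?F" "?F \<subseteq> carrier G" using a b finite_supp supp_subset by auto
  have c: "g \<in> carrier G" if "g \<in> ?F" for g using that F by blast
  have "supp (a \<oplus>\<^bsub>A\<^esub> b) \<subseteq> ?F" by (auto simp: supp_def add_apply)
  then have "aug (a \<oplus>\<^bsub>A\<^esub> b) = (\<Oplus>\<^bsub>R\<^esub>g\<in>?F. (a \<oplus>\<^bsub>A\<^esub> b) g)" using aug_eq F a b by simp
  also have "\<dots> = (\<Oplus>\<^bsub>R\<^esub>g\<in>?F. a g \<oplus>\<^bsub>R\<^esub> b g)"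
    using a b c by (intro R.finsum_cong') (auto simp: add_apply)
  also have "\<dots> = (\<Oplus>\<^bsub>R\<^esub>g\<in>?F. a g) \<oplus>\<^bsub>R\<^esub> (\<Oplus>\<^bsub>R\<^esub>g\<in>?F. b g)"
    using a b c by (intro R.finsum_addf) auto
  finally show "aug (a \<oplus>\<^bsub>A\<^esub> b) = aug a \<oplus>\<^bsub>R\<^esub> aug b"
    using aug_eq[OF a F(1) _ F(2)] aug_eq[OF b F(1) _ F(2)] by simp
qed (auto simp: aug_mult one_eq_single R.ring_axioms A.ring_axioms)

abbreviation scalar :: "'r \<Rightarrow> 'g \<Rightarrow> 'r"
  where "scalar r \<equiv> single r \<one>\<^bsub>G\<^esub>"

lemma scalar_hom: "ring_hom_ring R A scalar"
proof (rule ring_hom_ringI)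
  fix r s assume rs: "r \<in> carrier R" "s \<in> carrier R"
  then show "scalar (r \<otimes>\<^bsub>R\<^esub> s) = scalar r \<otimes>\<^bsub>A\<^esub> scalar s" by (simp add: single_mult_single)
  show "scalar (r \<oplus>\<^bsub>R\<^esub> s) = scalar r \<oplus>\<^bsub>A\<^esub> scalar s"
    using rs by (intro elem_eqI) (auto simp: add_apply single_apply)
qed (auto simp: one_eq_single R.ring_axioms A.ring_axioms)

lemma aug_surj: "aug ` carrier A = carrier R"
proof
  show "carrier R \<subseteq> aug ` carrier A"
  proof
    fix r assume "r \<in> carrier R"
    then show "r \<in> aug ` carrier A" by (intro image_eqI[of _ _ "scalar r"]) auto
  qed
qed auto

text \<open>By additivity it suffices to commute past monomials, where the group parts cause no
  obstruction and the coefficients commute by \<open>comm\<close>.\<close>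

lemma scalar_central:
  assumes comm: "\<And>s. s \<in> carrier R \<Longrightarrow> r \<otimes>\<^bsub>R\<^esub> s = s \<otimes>\<^bsub>R\<^esub> r" and r: "r \<in> carrier R" and a: "a \<in> carrier A"
  shows "scalar r \<otimes>\<^bsub>A\<^esub> a = a \<otimes>\<^bsub>A\<^esub> scalar r"
proof -
  have c: "h \<in> carrier G" if "h \<in> supp a" for h using that supp_subset by blast
  have E: "a = (\<Oplus>\<^bsub>A\<^esub>h\<in>supp a. single (a h) h)"
    using a finite_supp supp_subset by (intro eq_sum_of_singles) auto
  have "scalar r \<otimes>\<^bsub>A\<^esub> (\<Oplus>\<^bsub>A\<^esub>h\<in>supp a. single (a h) h) = (\<Oplus>\<^bsub>A\<^esub>h\<in>supp a. scalar r \<otimes>\<^bsub>A\<^esub> single (a h) h)"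
    using a c r finite_supp by (intro A.finsum_rdistr) auto
  also have "\<dots> = (\<Oplus>\<^bsub>A\<^esub>h\<in>supp a. single (a h) h \<otimes>\<^bsub>A\<^esub> scalar r)"
    using a c r comm by (intro A.finsum_cong') (auto simp: single_mult_single)
  also have "\<dots> = (\<Oplus>\<^bsub>A\<^esub>h\<in>supp a. single (a h) h) \<otimes>\<^bsub>A\<^esub> scalar r"
    using a c r finite_supp by (intro A.finsum_ldistr[symmetric]) auto
  finally show ?thesis using E by simp
qed

end

section \<open>Nilpotency of augmentation kernel elements and the passage from \<open>R\<close> to
  the group ring\<close>

context group_ring_over begin

lemma single_one_hom: "single \<one>\<^bsub>R\<^esub> \<in> hom G A"
  by (auto simp: hom_def single_mult_single)

lemma single_one_pow:
  "g \<in> carrier G \<Longrightarrow> single \<one>\<^bsub>R\<^esub> g [^]\<^bsub>A\<^esub> (n::nat) = single \<one>\<^bsub>R\<^esub> (g [^]\<^bsub>G\<^esub> n)"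
  by (induction n) (simp_all add: one_eq_single single_mult_single)

lemma add_pow_one_nilpotent:
  assumes "add_pow R (p::nat) \<one>\<^bsub>R\<^esub> \<in> nilpotents R"
  shows "add_pow A p \<one>\<^bsub>A\<^esub> \<in> nilpotents A"
proof -
  interpret s: ring_hom_ring R A scalar by (rule scalar_hom)
  have "add_pow A (n::nat) \<one>\<^bsub>A\<^esub> = scalar (add_pow R n \<one>\<^bsub>R\<^esub>)" for n
    by (induction n) simp_all
  moreover obtain n :: nat where "n \<ge> 1" "add_pow R p \<one>\<^bsub>R\<^esub> [^]\<^bsub>R\<^esub> n = \<zero>\<^bsub>R\<^esub>"
    using assms by (auto simp: nilpotents_def)
  moreover have "scalar (add_pow R p \<one>\<^bsub>R\<^esub>) [^]\<^bsub>A\<^esub> n = scalar (add_pow R p \<one>\<^bsub>R\<^esub> [^]\<^bsub>R\<^esub> n)"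
    by (simp add: s.hom_nat_pow)
  ultimately show ?thesis using s.hom_zero by (auto simp: nilpotents_def)
qed

text \<open>Subtract \<open>aug a\<close> times 1, which is zero, from the expansion of
  \<open>a\<close> into monomials. The elements \<open>h - 1\<close> thus span the augmentation
  kernel over \<open>R\<close>.\<close>

lemma augmentation_kernel_eq_sum:
  assumes a: "a \<in> carrier A" and 0: "aug a = \<zero>\<^bsub>R\<^esub>"
  shows "a = (\<Oplus>\<^bsub>A\<^esub>h\<in>supp a. scalar (a h) \<otimes>\<^bsub>A\<^esub> (single \<one>\<^bsub>R\<^esub> h \<ominus>\<^bsub>A\<^esub> \<one>\<^bsub>A\<^esub>))"
proof (rule elem_eqI)
  have c: "h \<in> carrier G" if "h \<in> supp a" for h using that supp_subset by blast
  show "(\<Oplus>\<^bsub>A\<^esub>h\<in>supp a. scalar (a h) \<otimes>\<^bsub>A\<^esub> (single \<one>\<^bsub>R\<^esub> h \<ominus>\<^bsub>A\<^esub> \<one>\<^bsub>A\<^esub>)) \<in> carrier A"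
    using a c by (intro A.finsum_closed) auto
  interpret s: ring_hom_ring R A scalar by (rule scalar_hom)
  have "(\<Oplus>\<^bsub>A\<^esub>h\<in>supp a. scalar (a h) \<otimes>\<^bsub>A\<^esub> (single \<one>\<^bsub>R\<^esub> h \<ominus>\<^bsub>A\<^esub> \<one>\<^bsub>A\<^esub>)) \<oplus>\<^bsub>A\<^esub> scalar (aug a)
      = (\<Oplus>\<^bsub>A\<^esub>h\<in>supp a. scalar (a h) \<otimes>\<^bsub>A\<^esub> (single \<one>\<^bsub>R\<^esub> h \<ominus>\<^bsub>A\<^esub> \<one>\<^bsub>A\<^esub>)) \<oplus>\<^bsub>A\<^esub> (\<Oplus>\<^bsub>A\<^esub>h\<in>supp a. scalar (a h))"
    unfolding aug_def using a c by (subst s.hom_finsum) (auto simp: comp_def)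
  also have "\<dots> = (\<Oplus>\<^bsub>A\<^esub>h\<in>supp a. scalar (a h) \<otimes>\<^bsub>A\<^esub> (single \<one>\<^bsub>R\<^esub> h \<ominus>\<^bsub>A\<^esub> \<one>\<^bsub>A\<^esub>) \<oplus>\<^bsub>A\<^esub> scalar (a h))"
    using a c by (intro A.finsum_addf[symmetric]) auto
  also have "\<dots> = (\<Oplus>\<^bsub>A\<^esub>h\<in>supp a. single (a h) h)"
  proof (rule A.finsum_cong')
    fix h assume "h \<in> supp a"
    then have h: "h \<in> carrier G" "a h \<in> carrier R" using a c by auto
    then have "scalar (a h) \<otimes>\<^bsub>A\<^esub> (single \<one>\<^bsub>R\<^esub> h \<ominus>\<^bsub>A\<^esub> \<one>\<^bsub>A\<^esub>) \<oplus>\<^bsub>A\<^esub> scalar (a h) = scalar (a h) \<otimes>\<^bsub>A\<^esub> single \<one>\<^bsub>R\<^esub> h"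
      by (simp add: A.minus_eq A.r_distr A.r_minus A.a_assoc A.l_neg)
    then show "scalar (a h) \<otimes>\<^bsub>A\<^esub> (single \<one>\<^bsub>R\<^esub> h \<ominus>\<^bsub>A\<^esub> \<one>\<^bsub>A\<^esub>) \<oplus>\<^bsub>A\<^esub> scalar (a h) = single (a h) h"
      using h by (simp add: single_mult_single)
  qed (use a c in auto)
  also have "\<dots> = a"
    using a finite_supp supp_subset by (intro eq_sum_of_singles[symmetric]) auto
  finally have E: "(\<Oplus>\<^bsub>A\<^esub>h\<in>supp a. scalar (a h) \<otimes>\<^bsub>A\<^esub> (single \<one>\<^bsub>R\<^esub> h \<ominus>\<^bsub>A\<^esub> \<one>\<^bsub>A\<^esub>)) \<oplus>\<^bsub>A\<^esub> scalar (aug a) = a" .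
  fix g assume "g \<in> carrier G"
  show "a g = (\<Oplus>\<^bsub>A\<^esub>h\<in>supp a. scalar (a h) \<otimes>\<^bsub>A\<^esub> (single \<one>\<^bsub>R\<^esub> h \<ominus>\<^bsub>A\<^esub> \<one>\<^bsub>A\<^esub>)) g"
    using E a c unfolding 0 by (simp add: Pi_def)
qed (fact a)

text \<open>The support generates a finite \<open>p\<close>-group. As a combination of the elements
  \<open>h - 1\<close>, \<open>a\<close> lowers the level in their annihilator chain, and 1 lies at
  some finite level.\<close>

lemma augmentation_kernel_nilpotent:
  assumes lf: "locally_finite_group G" and p: "Factorial_Ring.prime p" and G: "p_group p G"
    and nil: "add_pow R p \<one>\<^bsub>R\<^esub> \<in> nilpotents R"
    and a: "a \<in> carrier A" "aug a = \<zero>\<^bsub>R\<^esub>"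
  shows "\<exists>n::nat. a [^]\<^bsub>A\<^esub> n = \<zero>\<^bsub>A\<^esub>"
proof -
  interpret s: ring_hom_ring R A scalar by (rule scalar_hom)
  have c: "h \<in> carrier G" if "h \<in> supp a" for h using that supp_subset by blast
  let ?K = "generate G (supp a)"
  have K: "subgroup ?K G" using G.generate_is_subgroup[OF supp_subset] .
  interpret K: subgroup ?K G by fact
  let ?H = "G\<lparr>carrier := ?K\<rparr>"
  have fin: "finite (carrier ?H)"
    using lf finite_supp[OF a(1)] supp_subset by (simp add: locally_finite_group_def)
  let ?d = "single \<one>\<^bsub>R\<^esub>"
  let ?D = "(\<lambda>h. ?d h \<ominus>\<^bsub>A\<^esub> \<one>\<^bsub>A\<^esub>) ` carrier ?H"
  let ?L = "annihilator_chain A ?D"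
  have D: "?D \<subseteq> carrier A" by auto
  have L: "additive_subgroup (?L n) A" for n by (rule A.annihilator_chain_subgroup[OF D])
  have d: "?d \<in> hom ?H A" using single_one_hom K.mem_carrier by (simp add: hom_def Pi_def)
  have d1: "?d \<one>\<^bsub>?H\<^esub> = \<one>\<^bsub>A\<^esub>" unfolding one_eq_single by simp
  have "\<exists>n. \<one>\<^bsub>A\<^esub> \<in> ?L n"
    by (rule A.p_group_annihilator_chain_exhausts[OF G.subgroup_imp_group[OF K] fin
          G.p_group_subgroup[OF K G] p d d1 add_pow_one_nilpotent[OF nil] A.one_closed])
  then obtain n where n: "\<one>\<^bsub>A\<^esub> \<in> ?L n" by (rule exE)
  \<comment> \<open>The coefficients of \<open>a\<close> do not leave a level: scalars commute with
    every \<open>h - 1\<close>, even when \<open>R\<close> is noncommutative.\<close>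
  have scal: "scalar r \<otimes>\<^bsub>A\<^esub> y \<in> ?L n" if r: "r \<in> carrier R" and "y \<in> ?L n" for r y n
    using that(2)
  proof (induction n arbitrary: y)
    case 0
    then show ?case using r by simp
  next
    case (Suc n)
    then have y: "y \<in> carrier A" by simp
    have "(?d h \<ominus>\<^bsub>A\<^esub> \<one>\<^bsub>A\<^esub>) \<otimes>\<^bsub>A\<^esub> (scalar r \<otimes>\<^bsub>A\<^esub> y) \<in> ?L n" if h: "h \<in> ?K" for h
    proof -
      have hc: "h \<in> carrier G" using h by (rule K.mem_carrier)
      have "(?d h \<ominus>\<^bsub>A\<^esub> \<one>\<^bsub>A\<^esub>) \<otimes>\<^bsub>A\<^esub> scalar r = scalar r \<otimes>\<^bsub>A\<^esub> (?d h \<ominus>\<^bsub>A\<^esub> \<one>\<^bsub>A\<^esub>)"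
        using r hc by (simp add: A.minus_eq A.l_distr A.r_distr A.l_minus A.r_minus single_mult_single)
      then have "(?d h \<ominus>\<^bsub>A\<^esub> \<one>\<^bsub>A\<^esub>) \<otimes>\<^bsub>A\<^esub> (scalar r \<otimes>\<^bsub>A\<^esub> y) = scalar r \<otimes>\<^bsub>A\<^esub> ((?d h \<ominus>\<^bsub>A\<^esub> \<one>\<^bsub>A\<^esub>) \<otimes>\<^bsub>A\<^esub> y)"
        using r y by (simp flip: A.m_assoc)
      moreover have "(?d h \<ominus>\<^bsub>A\<^esub> \<one>\<^bsub>A\<^esub>) \<otimes>\<^bsub>A\<^esub> y \<in> ?L n" using Suc.prems h by auto
      ultimately show ?thesis using Suc.IH by simp
    qed
    then show ?case using r y by auto
  qed
  have "a \<otimes>\<^bsub>A\<^esub> y \<in> ?L n" if y: "y \<in> ?L (Suc n)" for n y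
  proof -
    have yc: "y \<in> carrier A" using y by simp
    let ?t = "\<lambda>h. scalar (a h) \<otimes>\<^bsub>A\<^esub> (?d h \<ominus>\<^bsub>A\<^esub> \<one>\<^bsub>A\<^esub>)"
    have tc: "?t \<in> supp a \<rightarrow> carrier A" using a c by auto
    have "a \<otimes>\<^bsub>A\<^esub> y = (\<Oplus>\<^bsub>A\<^esub>h\<in>supp a. ?t h) \<otimes>\<^bsub>A\<^esub> y"
      using augmentation_kernel_eq_sum[OF a] by simp
    also have "\<dots> = (\<Oplus>\<^bsub>A\<^esub>h\<in>supp a. ?t h \<otimes>\<^bsub>A\<^esub> y)"
      using finite_supp[OF a(1)] yc tc by (rule A.finsum_ldistr)
    also have "\<dots> \<in> ?L n"
    proof (rule additive_subgroup.finsum_in[OF L A.abelian_group_axioms])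
      fix h assume h: "h \<in> supp a"
      then have "(?d h \<ominus>\<^bsub>A\<^esub> \<one>\<^bsub>A\<^esub>) \<otimes>\<^bsub>A\<^esub> y \<in> ?L n" using y generate.incl[OF h] by auto
      then have "scalar (a h) \<otimes>\<^bsub>A\<^esub> ((?d h \<ominus>\<^bsub>A\<^esub> \<one>\<^bsub>A\<^esub>) \<otimes>\<^bsub>A\<^esub> y) \<in> ?L n"
        using a c[OF h] by (intro scal) auto
      then show "?t h \<otimes>\<^bsub>A\<^esub> y \<in> ?L n" using a c[OF h] yc by (simp add: A.m_assoc)
    qed
    finally show ?thesis .
  qed
  then show ?thesis using A.annihilator_chain_imp_nilpotent[OF a(1) _ n] by blast
qed

theorem generalized_quasi_t_fine_group_ring:
  assumes "generalized_quasi_t_fine R" "locally_finite_group G" "Factorial_Ring.prime p"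
    "p_group p G" "add_pow R p \<one>\<^bsub>R\<^esub> \<in> nilpotents R"
  shows "generalized_quasi_t_fine A"
proof -
  interpret aug: ring_hom_ring A R aug by (rule aug_hom)
  show ?thesis
  proof (rule aug.generalized_quasi_t_fine_lift[OF aug_surj _ scalar_hom _ assms(1)])
    fix k assume k: "k \<in> carrier A" "aug k = \<zero>\<^bsub>R\<^esub>"
    then obtain n :: nat where "k [^]\<^bsub>A\<^esub> n = \<zero>\<^bsub>A\<^esub>"
      using augmentation_kernel_nilpotent assms(2-5) by blast
    then show "\<one>\<^bsub>A\<^esub> \<ominus>\<^bsub>A\<^esub> k \<in> Units A" using k(1) A.one_minus_nilpotent_unit by blast
  qed simp
qed

end

section \<open>Commutative coefficients\<close>

locale t_fine_commutative_group_ring = group_ring_over R G A + R: cring R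
  for R :: "('r, 'm) ring_scheme" and G :: "('g, 'n) monoid_scheme" and A +
  assumes fine: "generalized_quasi_t_fine A"
begin

sublocale aug: ring_hom_ring A R aug by (rule aug_hom)

lemma one_not_zero: "\<one>\<^bsub>R\<^esub> \<noteq> \<zero>\<^bsub>R\<^esub>"
proof
  interpret s: ring_hom_ring R A scalar by (rule scalar_hom)
  assume "\<one>\<^bsub>R\<^esub> = \<zero>\<^bsub>R\<^esub>"
  then have "\<one>\<^bsub>A\<^esub> = \<zero>\<^bsub>A\<^esub>" using s.hom_one s.hom_zero by metis
  then show False using fine A.generalized_quasi_t_fine_iff by blast
qed

lemma aug_quasinilpotent: "q \<in> quasinilpotents A \<Longrightarrow> aug q \<in> quasinilpotents R"
  by (rule aug.quasinilpotent_image_central_section[OF scalar_hom])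
    (auto intro: scalar_central simp: R.m_comm)

text \<open>The augmentation maps radical into radical, so a scalar outside \<open>J(R)\<close>
  stays outside \<open>J(A)\<close>. Its decomposition in \<open>A\<close> is sent back to
  \<open>R\<close> by the augmentation.\<close>

lemma coefficient_ring_fine: "generalized_quasi_t_fine R"
  unfolding R.generalized_quasi_t_fine_iff
proof (intro conjI ballI one_not_zero)
  fix x assume x: "x \<in> carrier R - jacobson_radical R"
  then have "scalar x \<notin> jacobson_radical A"
    using aug.jacobson_image[OF aug_surj, of "scalar x"] by auto
  then obtain t q where tq: "t \<in> torsion_units A" "q \<in> quasinilpotents A" "scalar x = t \<oplus>\<^bsub>A\<^esub> q"
    using fine x unfolding A.generalized_quasi_t_fine_iff by blast
  have "t \<in> carrier A" "q \<in> carrier A" using tq by (auto simp: torsion_units_def quasinilpotents_def)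
  then have "x = aug t \<oplus>\<^bsub>R\<^esub> aug q" using tq(3) x aug.hom_add aug_single[of x "\<one>\<^bsub>G\<^esub>"] by auto
  then show "\<exists>t\<in>torsion_units R. \<exists>q\<in>quasinilpotents R. x = t \<oplus>\<^bsub>R\<^esub> q"
    using aug.torsion_unit_image[OF tq(1)] aug_quasinilpotent[OF tq(2)] by blast
qed

text \<open>A decomposition of \<open>a\<close> would present 0 as a unit plus a quasinilpotent
  element of \<open>R\<close>, and such a sum never lies in the radical.\<close>

lemma augmentation_kernel_jacobson:
  assumes a: "a \<in> carrier A" "aug a = \<zero>\<^bsub>R\<^esub>"
  shows "a \<in> jacobson_radical A"
proof (rule ccontr)
  assume "a \<notin> jacobson_radical A"
  then obtain t q where tq: "t \<in> torsion_units A" "q \<in> quasinilpotents A" "a = t \<oplus>\<^bsub>A\<^esub> q"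
    using fine a unfolding A.generalized_quasi_t_fine_iff by blast
  have "t \<in> carrier A" "q \<in> carrier A" using tq by (auto simp: torsion_units_def quasinilpotents_def)
  then have "aug t \<oplus>\<^bsub>R\<^esub> aug q = \<zero>\<^bsub>R\<^esub>" using tq(3) a(2) aug.hom_add by metis
  moreover have "aug t \<in> Units R"
    using tq(1) unfolding torsion_units_def by (intro aug.hom_Units) simp
  then have "aug t \<oplus>\<^bsub>R\<^esub> aug q \<notin> jacobson_radical R"
    using one_not_zero aug_quasinilpotent[OF tq(2)] by (intro R.unit_plus_quasinilpotent_not_jacobson)
  ultimately show False using additive_subgroup.zero_closed[OF R.jacobson_additive] by simp
qed

lemma unit_if_augmentation_unit:
  "y \<in> carrier A \<Longrightarrow> aug y \<in> Units R \<Longrightarrow> y \<in> Units A"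
  using aug.unit_lift[OF aug_surj] augmentation_kernel_jacobson A.one_minus_jacobson_unit by blast

section \<open>Orders of group elements when every element of unit augmentation is a unit\<close>

lemma single_one_inj:
  assumes "g \<in> carrier G" "single \<one>\<^bsub>R\<^esub> g = \<one>\<^bsub>A\<^esub>" shows "g = \<one>\<^bsub>G\<^esub>"
  using assms one_not_zero single_apply[of g "\<one>\<^bsub>R\<^esub>" g] single_apply[of g "\<one>\<^bsub>R\<^esub>" "\<one>\<^bsub>G\<^esub>"]
  by (auto simp: one_eq_single split: if_splits)

text \<open>The sum \<open>1 + g + ... + g^(q-1)\<close> has augmentation \<open>q\<close>, so it is
  a unit. Its product with \<open>1 - g\<close> is \<open>1 - g^q = 0\<close>, which forces
  \<open>g = 1\<close>.\<close>

lemma element_of_unit_order_trivial: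
  assumes g: "g \<in> carrier G" "g [^]\<^bsub>G\<^esub> (q::nat) = \<one>\<^bsub>G\<^esub>" and q: "add_pow R q \<one>\<^bsub>R\<^esub> \<in> Units R"
  shows "g = \<one>\<^bsub>G\<^esub>"
proof (rule single_one_inj[OF g(1)])
  let ?d = "single \<one>\<^bsub>R\<^esub> g"
  let ?s = "\<Oplus>\<^bsub>A\<^esub>i\<in>{..<q}. ?d [^]\<^bsub>A\<^esub> i"
  have d: "?d \<in> carrier A" by simp
  have s: "?s \<in> carrier A" using d by simp
  have "aug ?s = (\<Oplus>\<^bsub>R\<^esub>i\<in>{..<q}. \<one>\<^bsub>R\<^esub>)"
    using g d by (subst aug.hom_finsum) (auto simp: comp_def single_one_pow intro!: R.finsum_cong')
  then have "aug ?s \<in> Units R" using q R.add.finprod_const[of "\<one>\<^bsub>R\<^esub>" "{..<q}"] by simp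
  then have u: "?s \<in> Units A" using unit_if_augmentation_unit s by blast
  have "(\<one>\<^bsub>A\<^esub> \<ominus>\<^bsub>A\<^esub> ?d) \<otimes>\<^bsub>A\<^esub> ?s = \<one>\<^bsub>A\<^esub> \<ominus>\<^bsub>A\<^esub> ?d [^]\<^bsub>A\<^esub> q"
    by (rule A.geometric_sum(1)[OF d])
  also have "\<dots> = \<zero>\<^bsub>A\<^esub>" using g by (simp add: single_one_pow A.minus_eq A.r_neg flip: one_eq_single)
  finally have "(\<one>\<^bsub>A\<^esub> \<ominus>\<^bsub>A\<^esub> ?d) \<otimes>\<^bsub>A\<^esub> ?s \<otimes>\<^bsub>A\<^esub> inv\<^bsub>A\<^esub> ?s = \<zero>\<^bsub>A\<^esub>" using u by simp
  then have "\<one>\<^bsub>A\<^esub> \<ominus>\<^bsub>A\<^esub> ?d = \<zero>\<^bsub>A\<^esub>" using u d s by (simp add: A.m_assoc)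
  then show "?d = \<one>\<^bsub>A\<^esub>" using d by (metis A.one_closed A.r_right_minus_eq)
qed

text \<open>If \<open>g\<close> had infinite order, \<open>1 - g + g\<^sup>2\<close> would be a unit since its augmentation is \<open>1\<close>;
  comparing lowest and highest coefficients along the powers of \<open>g\<close> shows that it is not.\<close>

lemma no_element_of_infinite_order:
  assumes g: "g \<in> carrier G"
  shows "G.ord g \<noteq> 0"
proof
  assume ord: "G.ord g = 0"
  have pow_inj: "i = j" if "g [^]\<^bsub>G\<^esub> (i::int) = g [^]\<^bsub>G\<^esub> j" for i j
    using that g ord G.int_pow_eq[of g i j] by simp
  let ?d = "single \<one>\<^bsub>R\<^esub>"
  let ?y = "(\<one>\<^bsub>A\<^esub> \<ominus>\<^bsub>A\<^esub> ?d g) \<oplus>\<^bsub>A\<^esub> ?d (g \<otimes>\<^bsub>G\<^esub> g)"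
  have "aug ?y = \<one>\<^bsub>R\<^esub>" using g by (simp add: A.minus_eq R.r_neg)
  then have "?y \<in> Units A" using g by (intro unit_if_augmentation_unit) auto
  then obtain z where z: "z \<in> carrier A" "?y \<otimes>\<^bsub>A\<^esub> z = \<one>\<^bsub>A\<^esub>"
    using A.Units_r_inv A.Units_inv_closed by blast
  \<comment> \<open>Reading \<open>?y z = 1\<close> at the powers of \<open>g\<close> turns it into
    a linear recurrence for the coefficients of \<open>z\<close> there.\<close>
  define c where "c i = z (g [^]\<^bsub>G\<^esub> i)" for i :: int
  have cc: "c i \<in> carrier R" for i using z g by (simp add: c_def)
  have rec: "c i \<ominus>\<^bsub>R\<^esub> c (i - 1) \<oplus>\<^bsub>R\<^esub> c (i - 2) = (if i = 0 then \<one>\<^bsub>R\<^esub> else \<zero>\<^bsub>R\<^esub>)" for i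
  proof -
    let ?x = "g [^]\<^bsub>G\<^esub> i"
    have x: "?x \<in> carrier G" using g by simp
    have "?y \<otimes>\<^bsub>A\<^esub> z = (z \<ominus>\<^bsub>A\<^esub> ?d g \<otimes>\<^bsub>A\<^esub> z) \<oplus>\<^bsub>A\<^esub> ?d (g \<otimes>\<^bsub>G\<^esub> g) \<otimes>\<^bsub>A\<^esub> z"
      using z g by (simp add: A.l_distr A.minus_eq A.l_minus)
    then have "(?y \<otimes>\<^bsub>A\<^esub> z) ?x
      = z ?x \<ominus>\<^bsub>R\<^esub> z (inv\<^bsub>G\<^esub> g \<otimes>\<^bsub>G\<^esub> ?x) \<oplus>\<^bsub>R\<^esub> z (inv\<^bsub>G\<^esub> (g \<otimes>\<^bsub>G\<^esub> g) \<otimes>\<^bsub>G\<^esub> ?x)"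
      using z g x by (simp add: add_apply minus_apply single_mult_apply)
    moreover have "inv\<^bsub>G\<^esub> g \<otimes>\<^bsub>G\<^esub> ?x = g [^]\<^bsub>G\<^esub> (i - 1)"
      using g G.int_pow_mult[OF g, of "-1" i] by (simp add: G.int_pow_neg)
    moreover have "inv\<^bsub>G\<^esub> (g \<otimes>\<^bsub>G\<^esub> g) \<otimes>\<^bsub>G\<^esub> ?x = g [^]\<^bsub>G\<^esub> (i - 2)"
    proof -
      have "g \<otimes>\<^bsub>G\<^esub> g = g [^]\<^bsub>G\<^esub> (2::int)"
        using G.int_pow_mult[OF g, of 1 1] g by simp
      then show ?thesis
        using g G.int_pow_mult[OF g, of "-2" i] G.int_pow_neg[OF g, of 2] by simp
    qed
    moreover have "?x = \<one>\<^bsub>G\<^esub> \<longleftrightarrow> i = 0" using pow_inj[of i 0] by auto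
    then have "\<one>\<^bsub>A\<^esub> ?x = (if i = 0 then \<one>\<^bsub>R\<^esub> else \<zero>\<^bsub>R\<^esub>)"
      using x by (simp add: one_eq_single single_apply)
    ultimately show ?thesis using z(2) by (simp add: c_def)
  qed
  let ?I = "{i. c i \<noteq> \<zero>\<^bsub>R\<^esub>}"
  have "(\<lambda>i::int. g [^]\<^bsub>G\<^esub> i) ` ?I \<subseteq> supp z" using g by (auto simp: supp_def c_def)
  then have fin: "finite ?I"
    using finite_supp[OF z(1)] pow_inj by (meson finite_imageD finite_subset inj_onI)
  have ne: "?I \<noteq> {}"
  proof
    assume "?I = {}"
    then have "c 0 = \<zero>\<^bsub>R\<^esub>" "c (-1) = \<zero>\<^bsub>R\<^esub>" "c (-2) = \<zero>\<^bsub>R\<^esub>" by auto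
    then show False using rec[of 0] one_not_zero by (simp add: R.minus_eq)
  qed
  obtain M where M: "M \<in> ?I" "\<And>j. j \<in> ?I \<Longrightarrow> j \<le> M" using Max_in[OF fin ne] Max_ge[OF fin] by blast
  obtain m where m: "m \<in> ?I" "\<And>j. j \<in> ?I \<Longrightarrow> m \<le> j" using Min_in[OF fin ne] Min_le[OF fin] by blast
  \<comment> \<open>At index \<open>M + 2\<close> the recurrence reduces to the nonzero
    \<open>c M\<close>, so \<open>M + 2 = 0\<close>. At the lowest index it reduces to
    \<open>c m\<close>, so \<open>m = 0\<close>, which exceeds \<open>M\<close>.\<close>
  have "c (M + 2) = \<zero>\<^bsub>R\<^esub>" "c (1 + M) = \<zero>\<^bsub>R\<^esub>" using M(2)[of "M + 2"] M(2)[of "1 + M"] by auto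
  then have "M = - 2" using rec[of "M + 2"] cc[of M] M(1) by (auto simp: R.minus_eq split: if_splits)
  have "c (m - 1) = \<zero>\<^bsub>R\<^esub>" "c (m - 2) = \<zero>\<^bsub>R\<^esub>" using m(2)[of "m - 1"] m(2)[of "m - 2"] by auto
  then have "m = 0" using rec[of m] cc[of m] m(1) by (auto simp: R.minus_eq split: if_splits)
  then show False using M(2)[OF m(1)] \<open>M = - 2\<close> by simp
qed

text \<open>A prime \<open>q\<close> other than \<open>p\<close> is a unit in the local ring
  \<open>R\<close>. If it divided the order of \<open>g\<close>, then the power of \<open>g\<close>
  with exponent \<open>ord g / q\<close> would be trivial, although that exponent is positive and
  smaller than the order.\<close>

lemma group_is_p_group:
  assumes p: "Factorial_Ring.prime p" and pJ: "add_pow R p \<one>\<^bsub>R\<^esub> \<in> jacobson_radical R"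
  shows "p_group p G"
  unfolding p_group_def
proof
  fix g assume g: "g \<in> carrier G"
  show "\<exists>k. G.ord g = p ^ k"
  proof (rule power_of_prime_if_prime_divisors[OF p])
    show "G.ord g > 0" using no_element_of_infinite_order[OF g] by simp
    fix q assume q: "Factorial_Ring.prime q" "q dvd G.ord g"
    show "q = p"
    proof (rule ccontr)
      assume "q \<noteq> p"
      then have "coprime p q" using p q(1) primes_coprime by blast
      then have "add_pow R q \<one>\<^bsub>R\<^esub> \<notin> jacobson_radical R"
        using R.coprime_add_pow_one_not_jacobson[OF one_not_zero _ pJ] by blast
      then have u: "add_pow R q \<one>\<^bsub>R\<^esub> \<in> Units R"
        using R.generalized_quasi_t_fine_units[OF coefficient_ring_fine] by simp
      obtain m where m: "G.ord g = q * m" using q(2) by (elim dvdE)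
      have "(g [^]\<^bsub>G\<^esub> m) [^]\<^bsub>G\<^esub> q = \<one>\<^bsub>G\<^esub>"
        using g G.pow_ord_eq_1[OF g] m by (simp add: G.nat_pow_pow mult.commute)
      then have "g [^]\<^bsub>G\<^esub> m = \<one>\<^bsub>G\<^esub>"
        using element_of_unit_order_trivial[OF _ _ u] g by blast
      then have "G.ord g dvd m" using G.pow_eq_id[OF g] by blast
      moreover have "m > 0" using no_element_of_infinite_order[OF g] m by (intro gr0I) simp
      ultimately have "q * m \<le> m" using m dvd_imp_le by metis
      then show False using q(1) prime_ge_2_nat[of q] \<open>m > 0\<close> by simp
    qed
  qed
qed

end

theorem proposition3p10:
  fixes R :: "('r, 'm) ring_scheme" and G :: "('g, 'n) monoid_scheme"
  assumes "ring R" and "group G" and "carrier G \<noteq> {\<one>\<^bsub>G\<^esub>}"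
  shows "(\<forall>p::nat. generalized_quasi_t_fine R \<and> locally_finite_group G \<and>
             Factorial_Ring.prime p \<and> p_group p G \<and> [p] \<cdot>\<^bsub>R\<^esub> \<one>\<^bsub>R\<^esub> \<in> nilpotents R \<longrightarrow>
           generalized_quasi_t_fine (group_ring R G)) \<and>
         (cring R \<and> generalized_quasi_t_fine (group_ring R G) \<longrightarrow>
           generalized_quasi_t_fine R \<and>
           (\<exists>p::nat. Factorial_Ring.prime p \<and> p_group p G \<and> [p] \<cdot>\<^bsub>R\<^esub> \<one>\<^bsub>R\<^esub> \<in> jacobson_radical R))"
proof (intro conjI allI impI)
  have loc: "group_ring_over R G (group_ring R G)"
    using assms by (simp add: group_ring_over_def group_ring_over_axioms_def)
  fix p :: nat
  assume "generalized_quasi_t_fine R \<and> locally_finite_group G \<and>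
    Factorial_Ring.prime p \<and> p_group p G \<and> [p] \<cdot>\<^bsub>R\<^esub> \<one>\<^bsub>R\<^esub> \<in> nilpotents R"
  then show "generalized_quasi_t_fine (group_ring R G)"
    using group_ring_over.generalized_quasi_t_fine_group_ring[OF loc] by blast
next
  assume *: "cring R \<and> generalized_quasi_t_fine (group_ring R G)"
  interpret t_fine_commutative_group_ring R G "group_ring R G"
    using assms * by (simp add: t_fine_commutative_group_ring_def t_fine_commutative_group_ring_axioms_def
        group_ring_over_def group_ring_over_axioms_def)
  show "generalized_quasi_t_fine R" by (rule coefficient_ring_fine)
  show "\<exists>p::nat. Factorial_Ring.prime p \<and> p_group p G \<and> [p] \<cdot>\<^bsub>R\<^esub> \<one>\<^bsub>R\<^esub> \<in> jacobson_radical R"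
    using R.generalized_quasi_t_fine_residue_characteristic[OF coefficient_ring_fine] group_is_p_group
    by blast
qed

end
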